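(* Let $n_0=2^{r_0}\cdot3^{\epsilon_0}\cdot p_1\cdots p_{k_0}$, where $r_0,k_0\ge0$ are integers, $\epsilon_0\in\{0,1,2\}$, and $p_1,\dots,p_{k_0}\ge5$ are distinct primes. Suppose that there do not exist finite groups $G,N$ of order $n_0$ with $G$ insolvable, $N$ solvable and $\mathcal{E}'(G,N)\neq\emptyset$. Assume moreover: 1. every subgroup of index a power of two of any insolvable group of order $n_0$ is insolvable; 2. there is no non-abelian simple group of order $2^r\cdot n_0$ for any integer $r\ge1$; 3. if $n_0$ is even, then $n_0/2$ is a solvable number; 4. for every odd prime $p$ dividing $n_0$ and every integer $r\ge0$, the number $(2^r\cdot n_0)/p$ is solvable. Then for every integer $r\ge1$, there do not exist finite groups $G,N$ of order $2^r\cdot n_0$ with $G$ insolvable, $N$ solvable and $\mathcal{E}'(G,N)\neq\emptyset$.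
   Context: A positive integer $n$ is called solvable if every group of order $n$ is solvable. For a finite group $N$, let $\mathrm{Perm}(N)$ be the group of all permutations of the set $N$. A subgroup $\mathcal{G}\le \mathrm{Perm}(N)$ is regular if the map $\mathcal{G}\to N$, $\sigma\mapsto\sigma(1_N)$, is bijective. Let $\rho:N\to\mathrm{Perm}(N)$, $\rho(\eta)(x)=x\eta^{-1}$. The holomorph of $N$ is $\mathrm{Hol}(N)=\rho(N)\rtimes\mathrm{Aut}(N)\le\mathrm{Perm}(N)$. For a group $G$ with $|G|=|N|$, $\mathcal{E}'(G,N)$ denotes the set of regular subgroups of $\mathrm{Hol}(N)$ isomorphic to $G$. *)

theory Defs
  imports "HOL-Algebra.Algebra" "HOL-Computational_Algebra.Primes"
begin

text \<open>A positive integer n is solvable if every group of order n is solvable.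
  Groups are quantified over carriers in nat (every finite group is isomorphic to one).\<close>
definition solvable_number :: "nat \<Rightarrow> bool" where
  "solvable_number n \<longleftrightarrow>
     (\<forall>G :: nat monoid. group G \<and> finite (carrier G) \<and> order G = n \<longrightarrow> solvable G)"

definition rho_perm :: "('a, 'b) monoid_scheme \<Rightarrow> 'a \<Rightarrow> ('a \<Rightarrow> 'a)" where
  "rho_perm N \<eta> = (\<lambda>x \<in> carrier N. x \<otimes>\<^bsub>N\<^esub> inv\<^bsub>N\<^esub> \<eta>)"

definition Hol :: "('a, 'b) monoid_scheme \<Rightarrow> ('a \<Rightarrow> 'a) set" where
  "Hol N = {compose (carrier N) (rho_perm N \<eta>) \<alpha> | \<eta> \<alpha>. \<eta> \<in> carrier N \<and> \<alpha> \<in> auto N}"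

text \<open>E'(G,N): regular subgroups of Hol(N) isomorphic to G.\<close>
definition E' :: "('g, 'c) monoid_scheme \<Rightarrow> ('a, 'b) monoid_scheme \<Rightarrow> ('a \<Rightarrow> 'a) set set" where
  "E' G N = {H. subgroup H (BijGroup (carrier N)) \<and> H \<subseteq> Hol N
               \<and> bij_betw (\<lambda>\<sigma>. \<sigma> \<one>\<^bsub>N\<^esub>) H (carrier N)
               \<and> G \<cong> (BijGroup (carrier N)) \<lparr>carrier := H\<rparr>}"

end

theory Submission
  imports Defs
begin

text \<open>A regular subgroup of \<open>Hol(N)\<close> isomorphic to \<open>G\<close> amounts to an action \<open>f\<close> of \<open>G\<close> on \<open>N\<close> by
  automorphisms together with a bijective crossed homomorphism \<open>g : G \<rightarrow> N\<close>, where \<open>x\<close> corresponds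
  to the permutation \<open>a \<mapsto> f\<^sub>x(a) g(x)\<close>. If \<open>M\<close> is characteristic in \<open>N\<close>, then \<open>H = g\<^sup>-\<^sup>1(M)\<close> is a
  subgroup of \<open>G\<close> and \<open>g\<close> restricts to it.

  We argue by induction on \<open>r\<close>, with \<open>M\<close> such that \<open>N/M\<close> is elementary abelian of order \<open>p\<^sup>m > 1\<close>.
  For odd \<open>p\<close> the group \<open>H\<close> is solvable by hypothesis 4, and \<open>p\<^sup>m\<close> is a prime or \<open>9\<close>. The kernel of
  the action of \<open>G\<close> on \<open>N/M\<close> maps homomorphically to \<open>N/M\<close> with kernel inside \<open>H\<close>, and the image
  of the action is abelian or of order dividing \<open>48\<close>, hence solvable; so \<open>G\<close> is solvable. For
  \<open>p = 2\<close>, if \<open>H\<close> is insolvable, then \<open>|H| = 2\<^sup>s n\<^sub>0\<close> with \<open>s < r\<close>, which induction excludes.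

  It remains to see that an insolvable group of order \<open>2\<^sup>s n\<^sub>0\<close> has no solvable subgroup of 2-power
  index. For \<open>s > 0\<close> the group has a proper nontrivial normal subgroup \<open>K\<close>. One of \<open>K\<close> and the
  quotient is insolvable, and its order is again \<open>2\<close>-power times \<open>n\<^sub>0\<close> since all other divisors of \<open>2\<^sup>s n\<^sub>0\<close> are
  solvable numbers; the subgroup induces one of 2-power index in it.\<close>

section \<open>Solvability and orders along subgroups, images and kernels\<close>

lemma group_hom_inclusion:
  assumes "group G" "subgroup H G"
  shows "group_hom (G\<lparr>carrier := H\<rparr>) G id"
  using assms subgroup.subset[OF assms(2)]
  by (auto simp: group_hom_def group_hom_axioms_def hom_def subgroup.subgroup_is_group)

lemma solvable_subgroup_group:
  assumes "group G" "solvable G" "subgroup H G"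
  shows "solvable (G\<lparr>carrier := H\<rparr>)"
  using group_hom.inj_hom_imp_solvable[OF group_hom_inclusion[OF assms(1,3)]] assms(2) by simp

lemma solvable_subgroup_mono:
  assumes "group G" "subgroup K G" "solvable (G\<lparr>carrier := K\<rparr>)" "subgroup H G" "H \<subseteq> K"
  shows "solvable (G\<lparr>carrier := H\<rparr>)"
  using solvable_subgroup_group[OF subgroup.subgroup_is_group[OF assms(2,1)] assms(3)]
    group.subgroup_incl[OF assms(1,4,2,5)] by simp

lemma (in group_hom) group_hom_onto_image:
  "group_hom G (H\<lparr>carrier := h ` carrier G\<rparr>) h"
  using homh subgroup.subgroup_is_group[OF img_is_subgroup H.is_group] G.is_group
  by (auto simp: group_hom_def group_hom_axioms_def hom_def)

lemma (in group_hom) group_hom_restrict: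
  assumes "subgroup K G"
  shows "group_hom (G\<lparr>carrier := K\<rparr>) H h"
  using homh subgroup.subgroup_is_group[OF assms G.is_group] H.is_group subgroup.subset[OF assms]
  by (auto simp: group_hom_def group_hom_axioms_def hom_def subset_iff)

lemma (in group_hom) solvable_extension:
  assumes "solvable (H\<lparr>carrier := h ` carrier G\<rparr>)" "solvable (G\<lparr>carrier := kernel G H h\<rparr>)"
  shows "solvable G"
proof (rule solvable_condition)
  show "group_hom (G\<lparr>carrier := kernel G H h\<rparr>) G id"
    by (rule group_hom_inclusion[OF G.is_group subgroup_kernel])
  show "group_hom G (H\<lparr>carrier := h ` carrier G\<rparr>) h"
    by (rule group_hom_onto_image)
qed (use assms in \<open>auto simp: kernel_def\<close>)

lemma (in group_hom) order_eq_image_kernel: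
  "order G = card (h ` carrier G) * card (kernel G H h)"
proof -
  interpret I: group_hom G "H\<lparr>carrier := h ` carrier G\<rparr>" h
    by (rule group_hom_onto_image)
  have k: "kernel G (H\<lparr>carrier := h ` carrier G\<rparr>) h = kernel G H h"
    by (simp add: kernel_def)
  have "bij_betw (\<lambda>C. the_elem (h ` C)) (carrier (G Mod kernel G H h)) (h ` carrier G)"
    using I.FactGroup_iso_set k by (auto simp: iso_def)
  then have "card (rcosets\<^bsub>G\<^esub> kernel G H h) = card (h ` carrier G)"
    by (simp add: FactGroup_def bij_betw_same_card)
  then show ?thesis
    using G.lagrange[OF subgroup_kernel] by simp
qed

lemma (in group_hom) card_subgroup_eq_image_kernel:
  assumes "subgroup K G"
  shows "card K = card (h ` K) * card (K \<inter> kernel G H h)"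
proof -
  interpret R: group_hom "G\<lparr>carrier := K\<rparr>" H h by (rule group_hom_restrict[OF assms])
  have "kernel (G\<lparr>carrier := K\<rparr>) H h = K \<inter> kernel G H h"
    using subgroup.subset[OF assms] by (auto simp: kernel_def)
  then show ?thesis using R.order_eq_image_kernel by (simp add: order_def)
qed

lemma (in group) card_subgroup_dvd_order:
  assumes "subgroup H G" shows "card H dvd order G"
  using lagrange[OF assms] dvd_triv_right by metis

lemma solvable_iso:
  assumes "h \<in> iso G H" "group G" "group H" "solvable G"
  shows "solvable H"
proof -
  interpret group_hom G H h using assms by (auto simp: group_hom_def group_hom_axioms_def iso_def)
  show ?thesis using surj_hom_imp_solvable assms by (auto simp: iso_def bij_betw_def)
qed

lemma comm_group_solvable:
  assumes "comm_group G" shows "solvable G"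
proof -
  interpret comm_group G by fact
  have "(derived G ^^ 1) (carrier G) = {\<one>\<^bsub>G\<^esub>}" using derived_eq_singleton by simp
  then show ?thesis unfolding solvable_iff_trivial_derived_seq by blast
qed

section \<open>Copies with carriers in \<open>nat\<close>, and divisors of solvable numbers\<close>

text \<open>Solvable numbers and the hypotheses of the theorem speak of groups with carriers in
  \<open>nat\<close>. Quotients, products and permutation groups live on other types and are
  compared with them through such a copy.\<close>

lemma group_nat_copy:
  assumes "group G" "finite (carrier G)"
  obtains G' :: "nat monoid" and h where "group G'" "h \<in> iso G G'" "finite (carrier G')"
proof -
  interpret group G by fact
  obtain h where h: "bij_betw h (carrier G) {0..<card (carrier G)}"
    using ex_bij_betw_finite_nat[OF assms(2)] by blast
  define i where "i = inv_into (carrier G) h"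
  have ih: "i (h x) = x" if "x \<in> carrier G" for x
    using h that by (simp add: i_def bij_betw_def inv_into_f_f)
  define M where "M = \<lparr>carrier = {0..<card (carrier G)}, monoid.mult = (\<lambda>x y. h (i x \<otimes>\<^bsub>G\<^esub> i y)), one = h \<one>\<^bsub>G\<^esub>\<rparr>"
  have hom: "h \<in> hom G M"
    using h by (auto simp: hom_def M_def ih bij_betw_def)
  \<comment> \<open>\<open>hom_imp_img_group\<close> assumes no group laws of the codomain, so the
    product-preserving map \<open>h\<close> alone makes \<open>M\<close> a group.\<close>
  have "group (M\<lparr>carrier := h ` carrier G, one := h \<one>\<^bsub>G\<^esub>\<rparr>)"
    by (rule hom_imp_img_group[OF hom])
  moreover have "M\<lparr>carrier := h ` carrier G, one := h \<one>\<^bsub>G\<^esub>\<rparr> = M"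
    using h by (simp add: M_def bij_betw_def)
  ultimately have "group M" by simp
  moreover have "h \<in> iso G M" using hom h by (simp add: iso_def M_def)
  moreover have "finite (carrier M)" by (simp add: M_def)
  ultimately show thesis by (rule that)
qed

lemma iso_order:
  assumes "h \<in> iso G H" shows "order H = order G"
  using assms by (simp add: iso_def order_def) (metis bij_betw_same_card)

text \<open>The product of \<open>G\<close> with a cyclic group of order
  \<open>n div order G\<close> has order \<open>n\<close>, hence is solvable, and \<open>G\<close>
  is its image under the first projection.\<close>

lemma solvable_number_dvd:
  assumes "solvable_number n" "n > 0" "order G dvd n" "group G"
  shows "solvable G"
proof -
  interpret group G by fact
  obtain m where m: "n = order G * m" using assms(3) by blast
  let ?C = "integer_mod_group m"
  \<comment> \<open>\<open>integer_mod_group 0\<close> is the infinite group of integers, so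
    finiteness of the product rests on \<open>m > 0\<close>.\<close>
  have m0: "m > 0" and o: "order G > 0" using m assms(2) by auto
  interpret C: group ?C by simp
  interpret D: group "G \<times>\<times> ?C" by (rule DirProd_group) (auto simp: is_group)
  have fin: "finite (carrier (G \<times>\<times> ?C))"
    using o m0 by (auto simp: order_gt_0_iff_finite carrier_integer_mod_group)
  have ord: "order (G \<times>\<times> ?C) = n"
    using m m0 by (simp add: order_def card_cartesian_product carrier_integer_mod_group)
  obtain D :: "nat monoid" and h where D: "group D" "h \<in> iso (G \<times>\<times> ?C) D" "finite (carrier D)"
    using group_nat_copy[OF D.is_group fin] by blast
  have "solvable D" using assms(1) D iso_order[OF D(2)] ord by (simp add: solvable_number_def)
  then have s: "solvable (G \<times>\<times> ?C)"
    using solvable_iso[OF D.iso_set_sym[OF D(2)] D(1) D.is_group] by simp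
  interpret F: group_hom "G \<times>\<times> ?C" G fst
    by unfold_locales (auto simp: hom_def)
  have "fst ` carrier (G \<times>\<times> ?C) = carrier G"
    by (force simp: image_def intro: integer_mod_group_0)
  then show ?thesis using F.surj_hom_imp_solvable s by simp
qed

section \<open>Crossed homomorphisms, their restrictions and quotients\<close>

text \<open>The law \<open>g_mult\<close> is forced by composing the maps that send \<open>a\<close>
  to \<open>f x a\<close> times \<open>g x\<close>. Endomorphisms suffice for \<open>f x\<close>,
  since \<open>f_mult\<close> and \<open>f_one\<close> make them invertible on the carrier.
  Bijectivity of \<open>g\<close> is kept outside because it is lost on passing to the quotient by a
  nontrivial \<open>M\<close>.\<close>

locale crossed_hom = G: group G + N: group N
  for G :: "('a, 'c) monoid_scheme" and N :: "('b, 'd) monoid_scheme" +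
  fixes f :: "'a \<Rightarrow> 'b \<Rightarrow> 'b" and g :: "'a \<Rightarrow> 'b"
  assumes f_hom: "x \<in> carrier G \<Longrightarrow> f x \<in> hom N N"
    and f_mult: "\<lbrakk>x \<in> carrier G; y \<in> carrier G; a \<in> carrier N\<rbrakk> \<Longrightarrow> f (x \<otimes>\<^bsub>G\<^esub> y) a = f x (f y a)"
    and f_one: "a \<in> carrier N \<Longrightarrow> f \<one>\<^bsub>G\<^esub> a = a"
    and g_closed: "x \<in> carrier G \<Longrightarrow> g x \<in> carrier N"
    and g_mult: "\<lbrakk>x \<in> carrier G; y \<in> carrier G\<rbrakk> \<Longrightarrow> g (x \<otimes>\<^bsub>G\<^esub> y) = f x (g y) \<otimes>\<^bsub>N\<^esub> g x"
begin

lemma f_group_hom: "x \<in> carrier G \<Longrightarrow> group_hom N N (f x)"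
  using f_hom by (simp add: group_hom_def group_hom_axioms_def N.is_group)

lemma f_closed: "\<lbrakk>x \<in> carrier G; a \<in> carrier N\<rbrakk> \<Longrightarrow> f x a \<in> carrier N"
  using f_hom by (auto simp: hom_def)

lemma f_mult_dist:
  "\<lbrakk>x \<in> carrier G; a \<in> carrier N; b \<in> carrier N\<rbrakk> \<Longrightarrow> f x (a \<otimes>\<^bsub>N\<^esub> b) = f x a \<otimes>\<^bsub>N\<^esub> f x b"
  using f_hom by (auto simp: hom_def)

lemma f_inv_left: "\<lbrakk>x \<in> carrier G; a \<in> carrier N\<rbrakk> \<Longrightarrow> f (inv\<^bsub>G\<^esub> x) (f x a) = a"
  using f_mult[of "inv\<^bsub>G\<^esub> x" x a] f_one by simp

lemma f_inv_right: "\<lbrakk>x \<in> carrier G; a \<in> carrier N\<rbrakk> \<Longrightarrow> f x (f (inv\<^bsub>G\<^esub> x) a) = a"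
  using f_mult[of x "inv\<^bsub>G\<^esub> x" a] f_one by simp

lemma f_bij: "x \<in> carrier G \<Longrightarrow> bij_betw (f x) (carrier N) (carrier N)"
  by (rule bij_betw_byWitness[where f' = "f (inv\<^bsub>G\<^esub> x)"])
    (auto simp: f_inv_left f_inv_right f_closed)

lemma g_one: "g \<one>\<^bsub>G\<^esub> = \<one>\<^bsub>N\<^esub>"
  using g_mult[of "\<one>\<^bsub>G\<^esub>" "\<one>\<^bsub>G\<^esub>"] g_closed[of "\<one>\<^bsub>G\<^esub>"] f_one N.l_cancel_one' by fastforce

text \<open>The inclusion for the inverse of \<open>x\<close> yields the reverse inclusion for
  \<open>x\<close>.\<close>

lemma f_image_invariant:
  assumes "M \<subseteq> carrier N" "\<And>y. y \<in> carrier G \<Longrightarrow> f y ` M \<subseteq> M" "x \<in> carrier G"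
  shows "f x ` M = M"
proof
  show "M \<subseteq> f x ` M"
  proof
    fix a assume a: "a \<in> M"
    then have "f (inv\<^bsub>G\<^esub> x) a \<in> M" using assms by blast
    moreover have "a = f x (f (inv\<^bsub>G\<^esub> x) a)" using f_inv_right assms a by auto
    ultimately show "a \<in> f x ` M" by blast
  qed
qed (use assms in auto)

text \<open>As \<open>g\<close> is in general no homomorphism, a preimage of a subgroup can fail to
  be closed; invariance of \<open>M\<close> puts the twisted factor \<open>f x (g y)\<close> back
  into \<open>M\<close>.\<close>

lemma subgroup_g_vimage:
  assumes "subgroup M N" "\<And>x. x \<in> carrier G \<Longrightarrow> f x ` M \<subseteq> M"
  shows "subgroup {x \<in> carrier G. g x \<in> M} G"
proof (rule G.subgroupI)
  interpret M: subgroup M N by fact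
  show "{x \<in> carrier G. g x \<in> M} \<noteq> {}" using g_one M.one_closed by auto
  fix x assume x: "x \<in> {x \<in> carrier G. g x \<in> M}"
  have "f (inv\<^bsub>G\<^esub> x) (g x) \<otimes>\<^bsub>N\<^esub> g (inv\<^bsub>G\<^esub> x) = \<one>\<^bsub>N\<^esub>"
    using g_mult[of "inv\<^bsub>G\<^esub> x" x] x g_one by simp
  then have "g (inv\<^bsub>G\<^esub> x) = inv\<^bsub>N\<^esub> (f (inv\<^bsub>G\<^esub> x) (g x))"
    using x N.inv_equality[OF N.inv_comm] f_closed g_closed by simp
  moreover have "f (inv\<^bsub>G\<^esub> x) (g x) \<in> M" using x assms(2)[of "inv\<^bsub>G\<^esub> x"] by auto
  ultimately show "inv\<^bsub>G\<^esub> x \<in> {x \<in> carrier G. g x \<in> M}" using x M.m_inv_closed by simp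
  fix y assume y: "y \<in> {x \<in> carrier G. g x \<in> M}"
  have "f x (g y) \<in> M" using x y assms(2)[of x] by auto
  then show "x \<otimes>\<^bsub>G\<^esub> y \<in> {x \<in> carrier G. g x \<in> M}" using x y g_mult M.m_closed by simp
qed auto

text \<open>For characteristic \<open>M\<close> this is the smaller instance handed to the induction
  hypothesis.\<close>

lemma crossed_hom_restrict:
  assumes "subgroup M N" "\<And>x. x \<in> carrier G \<Longrightarrow> f x ` M \<subseteq> M"
  shows "crossed_hom (G\<lparr>carrier := {x \<in> carrier G. g x \<in> M}\<rparr>) (N\<lparr>carrier := M\<rparr>) f g"
proof -
  interpret M: subgroup M N by fact
  have h: "f x \<in> hom (N\<lparr>carrier := M\<rparr>) (N\<lparr>carrier := M\<rparr>)" if "x \<in> carrier G" for x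
    using that assms(2)[of x] f_mult_dist[of x] by (auto simp: hom_def)
  show ?thesis
    using subgroup.subgroup_is_group[OF subgroup_g_vimage[OF assms] G.is_group]
      subgroup.subgroup_is_group[OF assms(1) N.is_group]
    by (auto simp: crossed_hom_def crossed_hom_axioms_def h f_mult f_one g_mult)
qed

text \<open>Each \<open>f x\<close> maps \<open>M\<close> onto itself, hence the coset of
  \<open>a\<close> onto the coset of \<open>f x a\<close>, so the action and the crossed law descend
  to cosets.\<close>

lemma crossed_hom_quotient:
  assumes "M \<lhd> N" "\<And>x. x \<in> carrier G \<Longrightarrow> f x ` M \<subseteq> M"
  shows "crossed_hom G (N Mod M) (\<lambda>x C. f x ` C) (\<lambda>x. M #>\<^bsub>N\<^esub> g x)"
proof -
  interpret M: normal M N by fact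
  have sub: "C \<subseteq> carrier N" if "C \<in> carrier (N Mod M)" for C
    using that by (auto simp: FactGroup_def RCOSETS_def r_coset_def)
  have im: "f x ` (M #>\<^bsub>N\<^esub> a) = M #>\<^bsub>N\<^esub> f x a" if x: "x \<in> carrier G" and a: "a \<in> carrier N" for x a
  proof -
    have "f x ` (M #>\<^bsub>N\<^esub> a) = f x ` M #>\<^bsub>N\<^esub> f x a"
      unfolding r_coset_def using x a f_mult_dist M.subset by (simp add: image_UN subset_iff)
    then show ?thesis using f_image_invariant[OF M.subset assms(2) x] by simp
  qed
  have "group_hom N (N Mod M) (\<lambda>a. M #>\<^bsub>N\<^esub> a)"
    using M.r_coset_hom_Mod M.factorgroup_is_group N.is_group
    by (simp add: group_hom_def group_hom_axioms_def)
  then have cm: "M #>\<^bsub>N\<^esub> (a \<otimes>\<^bsub>N\<^esub> b) = (M #>\<^bsub>N\<^esub> a) \<otimes>\<^bsub>N Mod M\<^esub> (M #>\<^bsub>N\<^esub> b)"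
    if "a \<in> carrier N" "b \<in> carrier N" for a b
    using that by (simp add: group_hom.hom_mult)
  have carE: "\<exists>a\<in>carrier N. C = M #>\<^bsub>N\<^esub> a" if "C \<in> carrier (N Mod M)" for C
    using that by (auto simp: FactGroup_def RCOSETS_def)
  have carI: "M #>\<^bsub>N\<^esub> a \<in> carrier (N Mod M)" if "a \<in> carrier N" for a
    using that by (auto simp: FactGroup_def RCOSETS_def)
  show ?thesis
  proof (intro crossed_hom.intro crossed_hom_axioms.intro G.is_group M.factorgroup_is_group)
    fix x assume x: "x \<in> carrier G"
    show "(\<lambda>C. f x ` C) \<in> hom (N Mod M) (N Mod M)"
    proof (rule homI)
      fix C assume C: "C \<in> carrier (N Mod M)"
      obtain a where a: "a \<in> carrier N" "C = M #>\<^bsub>N\<^esub> a" using carE[OF C] by blast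
      show "f x ` C \<in> carrier (N Mod M)"
        unfolding a(2) im[OF x a(1)] by (rule carI[OF f_closed[OF x a(1)]])
    next
      fix C D assume CD: "C \<in> carrier (N Mod M)" "D \<in> carrier (N Mod M)"
      obtain a b where ab: "a \<in> carrier N" "C = M #>\<^bsub>N\<^esub> a" "b \<in> carrier N" "D = M #>\<^bsub>N\<^esub> b"
        using carE[OF CD(1)] carE[OF CD(2)] by blast
      show "f x ` (C \<otimes>\<^bsub>N Mod M\<^esub> D) = f x ` C \<otimes>\<^bsub>N Mod M\<^esub> f x ` D"
        unfolding ab(2,4) cm[OF ab(1,3), symmetric] im[OF x ab(1)] im[OF x ab(3)]
          im[OF x N.m_closed[OF ab(1,3)]] f_mult_dist[OF x ab(1,3)]
        by (rule cm[OF f_closed[OF x ab(1)] f_closed[OF x ab(3)]])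
    qed
    show "M #>\<^bsub>N\<^esub> g x \<in> carrier (N Mod M)" by (rule carI[OF g_closed[OF x]])
    fix y assume y: "y \<in> carrier G"
    show "M #>\<^bsub>N\<^esub> g (x \<otimes>\<^bsub>G\<^esub> y) = f x ` (M #>\<^bsub>N\<^esub> g y) \<otimes>\<^bsub>N Mod M\<^esub> (M #>\<^bsub>N\<^esub> g x)"
      unfolding g_mult[OF x y] im[OF x g_closed[OF y]]
      by (rule cm[OF f_closed[OF x g_closed[OF y]] g_closed[OF x]])
    fix C assume C: "C \<in> carrier (N Mod M)"
    show "f (x \<otimes>\<^bsub>G\<^esub> y) ` C = f x ` f y ` C"
      unfolding image_image by (rule image_cong[OF refl f_mult[OF x y subsetD[OF sub[OF C]]]])
  next
    fix C assume C: "C \<in> carrier (N Mod M)"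
    have "f \<one>\<^bsub>G\<^esub> ` C = (\<lambda>a. a) ` C"
      by (rule image_cong[OF refl f_one[OF subsetD[OF sub[OF C]]]])
    then show "f \<one>\<^bsub>G\<^esub> ` C = C" by simp
  qed
qed

text \<open>Conjugation by the isomorphisms \<open>u\<close> and \<open>v\<close>; it moves the
  problem to carriers in \<open>nat\<close>.\<close>

lemma crossed_hom_transfer:
  assumes u: "u \<in> iso G G'" and v: "v \<in> iso N N'" and "group G'" "group N'"
  shows "crossed_hom G' N' (\<lambda>x a. v (f (inv_into (carrier G) u x) (inv_into (carrier N) v a)))
    (\<lambda>x. v (g (inv_into (carrier G) u x)))"
proof -
  let ?u = "inv_into (carrier G) u" and ?v = "inv_into (carrier N) v"
  interpret U: group_hom G' G ?u
    using G.iso_set_sym[OF u] assms by (auto simp: group_hom_def group_hom_axioms_def iso_def G.is_group)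
  interpret V: group_hom N' N ?v
    using N.iso_set_sym[OF v] assms by (auto simp: group_hom_def group_hom_axioms_def iso_def N.is_group)
  interpret W: group_hom N N' v
    using v assms by (auto simp: group_hom_def group_hom_axioms_def iso_def N.is_group)
  have vl: "?v (v a) = a" if "a \<in> carrier N" for a
    using v that by (simp add: iso_def bij_betw_def inv_into_f_f)
  have vr: "v (?v a) = a" if "a \<in> carrier N'" for a
    using v that by (simp add: iso_def bij_betw_def f_inv_into_f)
  show ?thesis
    by unfold_locales (auto simp: hom_def vl vr f_closed f_mult f_one g_closed g_mult f_mult_dist)
qed

end

section \<open>Regular subgroups of the holomorph as crossed homomorphisms\<close>

text \<open>An element of the holomorph has the form \<open>a\<close> to \<open>\<alpha> a\<close>
  times the inverse of \<open>\<eta>\<close>. Its value at the identity is that inverse, which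
  becomes \<open>g x\<close>; cancelling it on the right recovers \<open>\<alpha>\<close>, which
  becomes \<open>f x\<close>. Regularity is then bijectivity of \<open>g\<close>.\<close>

lemma E'_imp_crossed_hom:
  assumes "group G" "group N" "E' G N \<noteq> {}"
  obtains f g where "crossed_hom G N f g" "bij_betw g (carrier G) (carrier N)"
proof -
  interpret G: group G by fact
  interpret N: group N by fact
  let ?B = "BijGroup (carrier N)"
  obtain H where sH: "subgroup H ?B" and HH: "H \<subseteq> Hol N"
    and reg: "bij_betw (\<lambda>\<sigma>. \<sigma> \<one>\<^bsub>N\<^esub>) H (carrier N)" and "G \<cong> ?B\<lparr>carrier := H\<rparr>"
    using assms(3) by (auto simp: E'_def)
  then obtain s where s: "s \<in> iso G (?B\<lparr>carrier := H\<rparr>)" by (auto simp: is_iso_def)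
  have sm: "s x \<in> H" if "x \<in> carrier G" for x using s that by (auto simp: iso_def hom_def)
  have sB: "s x \<in> Bij (carrier N)" if "x \<in> carrier G" for x
    using subgroup.subset[OF sH] sm[OF that] by (auto simp: BijGroup_def)
  have smult: "s (x \<otimes>\<^bsub>G\<^esub> y) a = s x (s y a)"
    if "x \<in> carrier G" "y \<in> carrier G" "a \<in> carrier N" for x y a
    using s that sB by (auto simp: iso_def hom_def BijGroup_def compose_def)
  have sone: "s \<one>\<^bsub>G\<^esub> a = a" if "a \<in> carrier N" for a
  proof -
    interpret S: group_hom G "?B\<lparr>carrier := H\<rparr>" s
      using s subgroup.subgroup_is_group[OF sH group_BijGroup]
      by (auto simp: group_hom_def group_hom_axioms_def iso_def G.is_group)
    show ?thesis using S.hom_one that by (simp add: BijGroup_def)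
  qed
  define g where "g = (\<lambda>x. s x \<one>\<^bsub>N\<^esub>)"
  define f where "f = (\<lambda>x a. s x a \<otimes>\<^bsub>N\<^esub> inv\<^bsub>N\<^esub> (g x))"
  have key: "f x \<in> hom N N \<and> g x \<in> carrier N \<and> (\<forall>a\<in>carrier N. s x a = f x a \<otimes>\<^bsub>N\<^esub> g x)"
    if x: "x \<in> carrier G" for x
  proof -
    obtain \<eta> \<alpha> where e: "\<eta> \<in> carrier N" "\<alpha> \<in> auto N" "s x = compose (carrier N) (rho_perm N \<eta>) \<alpha>"
      using sm[OF x] HH unfolding Hol_def by blast
    interpret A: group_hom N N \<alpha>
      using e(2) by (auto simp: auto_def group_hom_def group_hom_axioms_def N.is_group)
    have sx: "s x a = \<alpha> a \<otimes>\<^bsub>N\<^esub> inv\<^bsub>N\<^esub> \<eta>" if "a \<in> carrier N" for a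
      using that by (simp add: e(3) compose_def rho_perm_def)
    have gx: "g x = inv\<^bsub>N\<^esub> \<eta>" using e(1) by (simp add: g_def sx)
    have fx: "f x a = \<alpha> a" if "a \<in> carrier N" for a
      using that e(1) by (simp add: f_def sx gx N.m_assoc)
    show ?thesis using e(1) by (auto simp: hom_def fx gx sx)
  qed
  have fc: "f x a \<in> carrier N" if "x \<in> carrier G" "a \<in> carrier N" for x a
    using key[OF that(1)] that(2) by (auto simp: hom_def)
  have gc: "g x \<in> carrier N" and fhom: "f x \<in> hom N N" if "x \<in> carrier G" for x
    using key[OF that] by simp_all
  have gm: "g (x \<otimes>\<^bsub>G\<^esub> y) = f x (g y) \<otimes>\<^bsub>N\<^esub> g x" if "x \<in> carrier G" "y \<in> carrier G" for x y
  proof -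
    have "g (x \<otimes>\<^bsub>G\<^esub> y) = s x (g y)" using that by (simp add: g_def smult)
    then show ?thesis using key that by simp
  qed
  have "crossed_hom G N f g"
  proof (intro crossed_hom.intro crossed_hom_axioms.intro assms gm)
    fix x y a assume x: "x \<in> carrier G" and y: "y \<in> carrier G" and a: "a \<in> carrier N"
    have xy: "x \<otimes>\<^bsub>G\<^esub> y \<in> carrier G" using x y by simp
    \<comment> \<open>Both ways of evaluating \<open>s\<close> at the product end in the factor
      \<open>g (x y)\<close>, which \<open>gm\<close> makes visible and which cancels.\<close>
    have "f (x \<otimes>\<^bsub>G\<^esub> y) a \<otimes>\<^bsub>N\<^esub> g (x \<otimes>\<^bsub>G\<^esub> y) = s (x \<otimes>\<^bsub>G\<^esub> y) a"
      using key[OF xy] a by simp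
    also have "\<dots> = s x (s y a)" using x y a by (rule smult)
    also have "\<dots> = f x (f y a \<otimes>\<^bsub>N\<^esub> g y) \<otimes>\<^bsub>N\<^esub> g x"
      using x y a key fc by simp
    also have "\<dots> = f x (f y a) \<otimes>\<^bsub>N\<^esub> (f x (g y) \<otimes>\<^bsub>N\<^esub> g x)"
      using key x y fc a by (simp add: hom_def N.m_assoc)
    finally have "f (x \<otimes>\<^bsub>G\<^esub> y) a \<otimes>\<^bsub>N\<^esub> g (x \<otimes>\<^bsub>G\<^esub> y) = f x (f y a) \<otimes>\<^bsub>N\<^esub> g (x \<otimes>\<^bsub>G\<^esub> y)"
      by (simp only: gm[OF x y])
    then show "f (x \<otimes>\<^bsub>G\<^esub> y) a = f x (f y a)"
      by (rule N.r_cancel[OF _ fc[OF xy a] fc[OF x fc[OF y a]] gc[OF xy]])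
  next
    fix a assume "a \<in> carrier N"
    then show "f \<one>\<^bsub>G\<^esub> a = a" by (simp add: f_def g_def sone)
  qed (simp_all add: fhom gc)
  moreover have "bij_betw g (carrier G) (carrier N)"
  proof -
    have "bij_betw ((\<lambda>\<sigma>. \<sigma> \<one>\<^bsub>N\<^esub>) \<circ> s) (carrier G) (carrier N)"
      by (rule bij_betw_trans[OF _ reg]) (use s in \<open>simp add: iso_def\<close>)
    then show ?thesis by (simp add: g_def comp_def)
  qed
  ultimately show thesis by (rule that)
qed

text \<open>The converse direction, which translates the hypothesis on groups of order
  \<open>n0\<close> from regular subgroups to crossed homomorphisms.\<close>

lemma (in crossed_hom) E'_nonempty:
  assumes g: "bij_betw g (carrier G) (carrier N)"
  shows "E' G N \<noteq> {}"
proof -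
  let ?B = "BijGroup (carrier N)"
  define s where "s = (\<lambda>x. \<lambda>a\<in>carrier N. f x a \<otimes>\<^bsub>N\<^esub> g x)"
  have fa: "restrict (f x) (carrier N) \<in> auto N" if x: "x \<in> carrier G" for x
    using f_bij[OF x] f_mult_dist[OF x] f_closed[OF x]
    by (auto simp: auto_def hom_def Bij_def)
  have sx: "s x = compose (carrier N) (rho_perm N (inv\<^bsub>N\<^esub> g x)) (restrict (f x) (carrier N))"
    if "x \<in> carrier G" for x
    using that by (auto simp: s_def compose_def rho_perm_def f_closed g_closed)
  have sHol: "s x \<in> Hol N" if "x \<in> carrier G" for x
    unfolding Hol_def using sx[OF that] fa[OF that] g_closed[OF that] N.inv_closed by blast
  have sB: "s x \<in> Bij (carrier N)" if x: "x \<in> carrier G" for x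
  proof -
    have "bij_betw (rho_perm N \<eta>) (carrier N) (carrier N)" if "\<eta> \<in> carrier N" for \<eta>
      by (rule bij_betw_byWitness[where f' = "\<lambda>a. a \<otimes>\<^bsub>N\<^esub> \<eta>"])
        (use that in \<open>auto simp: rho_perm_def N.m_assoc\<close>)
    then have "rho_perm N (inv\<^bsub>N\<^esub> g x) \<in> Bij (carrier N)"
      using g_closed[OF x] by (simp add: Bij_def) (simp add: rho_perm_def)
    then show ?thesis
      unfolding sx[OF x] using fa[OF x] by (intro compose_Bij) (auto simp: auto_def)
  qed
  interpret S: group_hom G ?B s
  proof (intro group_hom.intro group_hom_axioms.intro G.is_group group_BijGroup homI)
    fix x y assume x: "x \<in> carrier G" and y: "y \<in> carrier G"
    show "s (x \<otimes>\<^bsub>G\<^esub> y) = s x \<otimes>\<^bsub>?B\<^esub> s y"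
      using x y sB by (auto simp: BijGroup_def compose_def s_def f_mult g_mult f_closed g_closed
          f_mult_dist N.m_assoc)
  qed (use sB in \<open>auto simp: BijGroup_def\<close>)
  \<comment> \<open>Evaluation at the identity returns \<open>g\<close>. This gives both injectivity
    of \<open>s\<close> and regularity of its image.\<close>
  have s1: "s x \<one>\<^bsub>N\<^esub> = g x" if "x \<in> carrier G" for x
    using group_hom.hom_one[OF f_group_hom[OF that]] g_closed[OF that] by (simp add: s_def)
  have inj: "inj_on s (carrier G)"
    using g s1 by (metis bij_betw_def inj_on_def)
  have "s ` carrier G \<in> E' G N"
    unfolding E'_def
  proof (intro CollectI conjI)
    show "subgroup (s ` carrier G) ?B" by (rule S.img_is_subgroup)
    show "s ` carrier G \<subseteq> Hol N" using sHol by blast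
    have "bij_betw (\<lambda>x. (\<lambda>\<sigma>. \<sigma> \<one>\<^bsub>N\<^esub>) (s x)) (carrier G) (carrier N)"
      using g s1 by (simp cong: bij_betw_cong)
    moreover have "bij_betw s (carrier G) (s ` carrier G)" using inj by (simp add: bij_betw_def)
    ultimately show "bij_betw (\<lambda>\<sigma>. \<sigma> \<one>\<^bsub>N\<^esub>) (s ` carrier G) (carrier N)"
      using bij_betw_comp_iff[of s "carrier G" "s ` carrier G" "\<lambda>\<sigma>. \<sigma> \<one>\<^bsub>N\<^esub>"] by (simp add: comp_def)
    have "s \<in> iso G (?B\<lparr>carrier := s ` carrier G\<rparr>)"
      using S.group_hom_onto_image inj by (auto simp: iso_def bij_betw_def group_hom_def group_hom_axioms_def)
    then show "G \<cong> ?B\<lparr>carrier := s ` carrier G\<rparr>" by (auto simp: is_iso_def)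
  qed
  then show ?thesis by blast
qed

section \<open>Solvability from the action on an abelian group\<close>

context crossed_hom
begin

text \<open>Elements of \<open>BijGroup\<close> are extensional functions, hence the restriction to
  the carrier.\<close>

definition act :: "'a \<Rightarrow> 'b \<Rightarrow> 'b" where
  "act x = restrict (f x) (carrier N)"

lemma f_inj: "\<lbrakk>x \<in> carrier G; a \<in> carrier N; b \<in> carrier N\<rbrakk> \<Longrightarrow> f x a = f x b \<longleftrightarrow> a = b"
  using f_inv_left by metis

lemma act_hom: "group_hom G (BijGroup (carrier N)) act"
proof (intro group_hom.intro group_hom_axioms.intro G.is_group group_BijGroup homI)
  have B: "act x \<in> Bij (carrier N)" if x: "x \<in> carrier G" for x
    using f_bij[OF x] by (simp add: act_def Bij_def)
  fix x assume x: "x \<in> carrier G"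
  show "act x \<in> carrier (BijGroup (carrier N))" using B[OF x] by (simp add: BijGroup_def)
  fix y assume y: "y \<in> carrier G"
  show "act (x \<otimes>\<^bsub>G\<^esub> y) = act x \<otimes>\<^bsub>BijGroup (carrier N)\<^esub> act y"
    using x y B[OF x] B[OF y] by (auto simp: BijGroup_def compose_def act_def f_mult f_closed)
qed

lemma kernel_act: "kernel G (BijGroup (carrier N)) act = {x \<in> carrier G. \<forall>a\<in>carrier N. f x a = a}"
  by (auto simp: kernel_def BijGroup_def act_def fun_eq_iff restrict_def)

lemma subgroup_fixed:
  assumes x: "x \<in> carrier G"
  shows "subgroup {a \<in> carrier N. f x a = a} N"
proof -
  interpret F: group_hom N N "f x" by (rule f_group_hom[OF x])
  show ?thesis by (rule N.subgroupI) (auto intro: exI[of _ "\<one>\<^bsub>N\<^esub>"])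
qed

text \<open>Two extensions: \<open>G\<close> over the kernel of the action, and that kernel over the
  part of it where \<open>g\<close> is trivial. In the application \<open>N\<close> is the quotient
  N/M, and the fibre of \<open>g\<close> over the identity is the subgroup H.\<close>

lemma solvable_if_comm:
  assumes "comm_group N"
    and H: "solvable (G\<lparr>carrier := {x \<in> carrier G. g x = \<one>\<^bsub>N\<^esub>}\<rparr>)"
    and im: "solvable (BijGroup (carrier N)\<lparr>carrier := act ` carrier G\<rparr>)"
  shows "solvable G"
proof -
  interpret A: group_hom G "BijGroup (carrier N)" act by (rule act_hom)
  interpret N: comm_group N by fact
  let ?K = "kernel G (BijGroup (carrier N)) act"
  have "subgroup {x \<in> carrier G. g x \<in> {\<one>\<^bsub>N\<^esub>}} G"
    by (rule subgroup_g_vimage[OF N.triv_subgroup]) (use f_group_hom group_hom.hom_one in fastforce)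
  then have sH: "subgroup {x \<in> carrier G. g x = \<one>\<^bsub>N\<^esub>} G" by simp
  \<comment> \<open>Where the action is trivial, the crossed law says that \<open>g\<close> reverses
    products; commutativity of \<open>N\<close> turns this into a homomorphism.\<close>
  interpret gK: group_hom "G\<lparr>carrier := ?K\<rparr>" N g
  proof (intro group_hom.intro group_hom_axioms.intro homI)
    show "group (G\<lparr>carrier := ?K\<rparr>)"
      by (rule subgroup.subgroup_is_group[OF A.subgroup_kernel G.is_group])
  qed (auto simp: kernel_act g_mult g_closed N.m_comm N.is_group)
  have kk: "kernel (G\<lparr>carrier := ?K\<rparr>) N g \<subseteq> {x \<in> carrier G. g x = \<one>\<^bsub>N\<^esub>}"
    by (auto simp: kernel_def)
  have "solvable (G\<lparr>carrier := ?K\<rparr>)"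
  proof (rule gK.solvable_extension)
    show "solvable (N\<lparr>carrier := g ` carrier (G\<lparr>carrier := ?K\<rparr>)\<rparr>)"
      by (rule solvable_subgroup_group[OF N.is_group comm_group_solvable gK.img_is_subgroup])
        (rule assms(1))
    have "subgroup (kernel (G\<lparr>carrier := ?K\<rparr>) N g) G"
      using G.incl_subgroup[OF A.subgroup_kernel gK.subgroup_kernel] .
    then show "solvable (G\<lparr>carrier := ?K\<rparr>\<lparr>carrier := kernel (G\<lparr>carrier := ?K\<rparr>) N g\<rparr>)"
      using solvable_subgroup_mono[OF G.is_group sH H _ kk] by simp
  qed
  then show ?thesis using A.solvable_extension[OF im] by simp
qed

text \<open>A group of prime order is generated by any \<open>c\<close> other than the identity, so
  its automorphisms are power maps. These commute, and the image of the action is abelian.\<close>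

lemma solvable_if_prime_order:
  assumes "comm_group N" "Factorial_Ring.prime (order N)"
    and H: "solvable (G\<lparr>carrier := {x \<in> carrier G. g x = \<one>\<^bsub>N\<^esub>}\<rparr>)"
  shows "solvable G"
proof (rule solvable_if_comm[OF assms(1) H])
  interpret A: group_hom G "BijGroup (carrier N)" act by (rule act_hom)
  have "order N > 1" using assms(2) prime_gt_1_nat by blast
  then have "carrier N \<noteq> {\<one>\<^bsub>N\<^esub>}" by (auto simp: order_def)
  then obtain c where c: "c \<in> carrier N" "c \<noteq> \<one>\<^bsub>N\<^esub>" using N.one_closed by blast
  have fin: "finite (carrier N)" using \<open>order N > 1\<close> by (metis N.order_gt_0_iff_finite less_trans zero_less_one)
  have sg: "subgroup (generate N {c}) N" using c by (intro N.generate_is_subgroup) auto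
  have cg: "c \<in> generate N {c}" by (simp add: generate.incl)
  have "card (generate N {c}) dvd order N" by (rule N.card_subgroup_dvd_order[OF sg])
  moreover have "card (generate N {c}) \<noteq> 1"
    using cg c(2) subgroup.one_closed[OF sg] by (metis card_1_singletonE singletonD)
  ultimately have "card (generate N {c}) = card (carrier N)"
    using assms(2) by (auto simp: prime_nat_iff order_def)
  then have "generate N {c} = carrier N"
    using card_subset_eq[OF fin subgroup.subset[OF sg]] by simp
  then have gen: "\<exists>k::int. a = c [^]\<^bsub>N\<^esub> k" if "a \<in> carrier N" for a
    using N.generate_pow[OF c(1)] that by auto
  have com: "f x (f y a) = f y (f x a)"
    if x: "x \<in> carrier G" and y: "y \<in> carrier G" and a: "a \<in> carrier N" for x y a
  proof -
    interpret X: group_hom N N "f x" by (rule f_group_hom[OF x])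
    interpret Y: group_hom N N "f y" by (rule f_group_hom[OF y])
    obtain i where i: "f x c = c [^]\<^bsub>N\<^esub> (i::int)" using gen[OF f_closed[OF x c(1)]] by blast
    obtain j where j: "f y c = c [^]\<^bsub>N\<^esub> (j::int)" using gen[OF f_closed[OF y c(1)]] by blast
    obtain k where k: "a = c [^]\<^bsub>N\<^esub> (k::int)" using gen[OF a] by blast
    have "f x (f y a) = c [^]\<^bsub>N\<^esub> (i * (j * k))" "f y (f x a) = c [^]\<^bsub>N\<^esub> (j * (i * k))"
      unfolding k X.hom_int_pow[OF c(1)] Y.hom_int_pow[OF c(1)] i j N.int_pow_pow[OF c(1)]
      by (simp_all only: X.hom_int_pow[OF c(1)] Y.hom_int_pow[OF c(1)] i j N.int_pow_pow[OF c(1)])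
    then show ?thesis by (simp only: mult.left_commute)
  qed
  interpret I: group "BijGroup (carrier N)\<lparr>carrier := act ` carrier G\<rparr>"
    by (rule subgroup.subgroup_is_group[OF A.img_is_subgroup group_BijGroup])
  have "comm_group (BijGroup (carrier N)\<lparr>carrier := act ` carrier G\<rparr>)"
  proof (rule I.group_comm_groupI)
    fix s t assume "s \<in> carrier (BijGroup (carrier N)\<lparr>carrier := act ` carrier G\<rparr>)"
      "t \<in> carrier (BijGroup (carrier N)\<lparr>carrier := act ` carrier G\<rparr>)"
    then obtain x y where xy: "x \<in> carrier G" "y \<in> carrier G" "s = act x" "t = act y" by auto
    have "act (x \<otimes>\<^bsub>G\<^esub> y) = act (y \<otimes>\<^bsub>G\<^esub> x)"
      using xy com by (auto simp: act_def f_mult)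
    then show "s \<otimes>\<^bsub>BijGroup (carrier N)\<lparr>carrier := act ` carrier G\<rparr>\<^esub> t =
        t \<otimes>\<^bsub>BijGroup (carrier N)\<lparr>carrier := act ` carrier G\<rparr>\<^esub> s"
      using xy A.hom_mult by simp
  qed
  then show "solvable (BijGroup (carrier N)\<lparr>carrier := act ` carrier G\<rparr>)"
    by (rule comm_group_solvable)
qed

text \<open>The image of \<open>G\<close> permutes the \<open>8 \<cdot> 6\<close> ordered bases of \<open>N\<close> freely.\<close>

lemma card_act_dvd_48:
  assumes "finite (carrier G)" and o: "order N = 9"
    and ex: "\<And>a. a \<in> carrier N \<Longrightarrow> a \<otimes>\<^bsub>N\<^esub> a \<otimes>\<^bsub>N\<^esub> a = \<one>\<^bsub>N\<^esub>"
  shows "card (act ` carrier G) dvd 48"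
proof -
  interpret A: group_hom G "BijGroup (carrier N)" act by (rule act_hom)
  let ?K = "kernel G (BijGroup (carrier N)) act"
  have fin: "finite (carrier N)" using o by (simp add: order_def card_ge_0_finite)
  \<comment> \<open>Since \<open>a\<close> has order 3, \<open>L a\<close> is the line spanned by
    \<open>a\<close>. Thus \<open>S\<close> consists of the ordered bases of a plane over the field
    with three elements.\<close>
  define L where "L a = {\<one>\<^bsub>N\<^esub>, a, a \<otimes>\<^bsub>N\<^esub> a}" for a
  define S where "S = (SIGMA a : carrier N - {\<one>\<^bsub>N\<^esub>}. carrier N - L a)"
  have Lc: "card (L a) = 3" "L a \<subseteq> carrier N" if a: "a \<in> carrier N - {\<one>\<^bsub>N\<^esub>}" for a
  proof -
    have "a \<otimes>\<^bsub>N\<^esub> a \<noteq> \<one>\<^bsub>N\<^esub>" using ex[of a] a by auto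
    moreover have "a \<otimes>\<^bsub>N\<^esub> a \<noteq> a" using a N.l_cancel_one'[of a a] by auto
    ultimately show "card (L a) = 3" "L a \<subseteq> carrier N" using a by (auto simp: L_def)
  qed
  have "card S = (\<Sum>a\<in>carrier N - {\<one>\<^bsub>N\<^esub>}. card (carrier N - L a))"
    unfolding S_def by (rule card_SigmaI) (use fin in auto)
  also have "\<dots> = (\<Sum>a\<in>carrier N - {\<one>\<^bsub>N\<^esub>}. 6)"
  proof (rule sum.cong[OF refl])
    fix a assume a: "a \<in> carrier N - {\<one>\<^bsub>N\<^esub>}"
    show "card (carrier N - L a) = 6"
      using Lc[OF a] o fin by (simp add: card_Diff_subset finite_subset order_def)
  qed
  also have "\<dots> = 48" using o fin by (simp add: order_def card_Diff_singleton)
  finally have S48: "card S = 48" .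
  \<comment> \<open>The diagonal action on bases, made extensional so that it takes values in
    \<open>BijGroup S\<close>.\<close>
  define \<phi> where "\<phi> x = (\<lambda>p\<in>S. (f x (fst p), f x (snd p)))" for x
  have fS: "(f x a, f x b) \<in> S" if x: "x \<in> carrier G" and ab: "(a, b) \<in> S" for x a b
  proof -
    have one: "f x \<one>\<^bsub>N\<^esub> = \<one>\<^bsub>N\<^esub>" using group_hom.hom_one[OF f_group_hom[OF x]] .
    have a: "a \<in> carrier N" and b: "b \<in> carrier N" using ab by (auto simp: S_def)
    have "f x a \<noteq> \<one>\<^bsub>N\<^esub>" "f x b \<noteq> \<one>\<^bsub>N\<^esub>" "f x b \<noteq> f x a" "f x b \<noteq> f x (a \<otimes>\<^bsub>N\<^esub> a)"
      using f_inj[OF x a N.one_closed] f_inj[OF x b N.one_closed] f_inj[OF x b a]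
        f_inj[OF x b N.m_closed[OF a a]] ab one by (auto simp: S_def L_def)
    then show ?thesis using a b x by (auto simp: S_def L_def f_closed f_mult_dist)
  qed
  have Sc: "a \<in> carrier N" "b \<in> carrier N" if "(a, b) \<in> S" for a b using that by (auto simp: S_def)
  have \<phi>B: "\<phi> x \<in> Bij S" if x: "x \<in> carrier G" for x
  proof -
    have "bij_betw (\<phi> x) S S"
      by (rule bij_betw_byWitness[where f' = "\<phi> (inv\<^bsub>G\<^esub> x)"])
        (use x in \<open>auto simp: \<phi>_def fS f_inv_left f_inv_right Sc\<close>)
    then show ?thesis by (simp add: Bij_def \<phi>_def)
  qed
  interpret P: group_action G S \<phi>
    unfolding group_action_def
  proof (intro group_hom.intro group_hom_axioms.intro G.is_group group_BijGroup homI)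
    fix x y assume x: "x \<in> carrier G" and y: "y \<in> carrier G"
    show "\<phi> (x \<otimes>\<^bsub>G\<^esub> y) = \<phi> x \<otimes>\<^bsub>BijGroup S\<^esub> \<phi> y"
      using x y \<phi>B[OF x] \<phi>B[OF y]
      by (auto simp: BijGroup_def compose_def \<phi>_def fun_eq_iff fS f_mult Sc)
  qed (use \<phi>B in \<open>auto simp: BijGroup_def\<close>)
  \<comment> \<open>Freeness: the fixed points of \<open>x\<close> form a subgroup. If it contains a
    basis it has at least 4 elements, and the only divisor of 9 that large is 9 itself.\<close>
  have stab: "stabilizer G \<phi> p = ?K" if p: "p \<in> S" for p
  proof -
    obtain a b where ab: "p = (a, b)" by (cases p)
    have pS: "(a, b) \<in> S" using p ab by simp
    have "\<forall>c\<in>carrier N. f x c = c" if x: "x \<in> carrier G" and fx: "f x a = a" "f x b = b" for x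
    proof -
      let ?F = "{c \<in> carrier N. f x c = c}"
      have sF: "subgroup ?F N" by (rule subgroup_fixed[OF x])
      have "insert b (L a) \<subseteq> ?F"
        using subgroup.one_closed[OF sF] subgroup.m_closed[OF sF, of a a] Sc[OF pS] fx
        by (auto simp: L_def)
      moreover have "card (insert b (L a)) = 4"
        using pS Lc[of a] by (auto simp: S_def card_insert_disjoint finite_subset[OF _ fin])
      ultimately have "card ?F \<ge> 4"
        using card_mono[OF finite_subset[OF subgroup.subset[OF sF] fin], of "insert b (L a)"]
        by (simp only:)
      have dv: "card ?F dvd 9" using N.card_subgroup_dvd_order[OF sF] unfolding o .
      have "card ?F \<le> 9" using dv by (rule dvd_imp_le) simp
      have "card ?F = 9"
      proof -
        define n where "n = card ?F"
        have "n \<in> {4,5,6,7,8,9}" "n dvd 9"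
          using \<open>card ?F \<ge> 4\<close> \<open>card ?F \<le> 9\<close> dv unfolding n_def[symmetric] by auto
        then show ?thesis unfolding n_def[symmetric] by auto
      qed
      then have "?F = carrier N" using card_subset_eq[OF fin, of ?F] o by (simp add: order_def)
      then show ?thesis by blast
    qed
    then show ?thesis
      using p ab Sc[OF pS] by (auto simp: stabilizer_def kernel_act \<phi>_def)
  qed
  have K0: "card ?K > 0"
    using assms(1) A.subgroup_kernel subgroup.finite_imp_card_positive by blast
  \<comment> \<open>All stabilizers equal the kernel, so every orbit is as large as the image of
    \<open>G\<close>; the orbits partition the 48 bases.\<close>
  have orb: "card (act ` carrier G) = card C" if C: "C \<in> orbits G S \<phi>" for C
  proof -
    obtain p where p: "p \<in> S" "C = orbit G \<phi> p" using C by (auto simp: orbits_def)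
    have "card C * card ?K = order G"
      using P.orbit_stabilizer_theorem[OF p(1)] stab[OF p(1)] p(2) by (simp add: mult.commute)
    then have "card C * card ?K = card (act ` carrier G) * card ?K"
      using A.order_eq_image_kernel by simp
    then show ?thesis using K0 by simp
  qed
  have U: "\<Union>(orbits G S \<phi>) = S" by (rule P.orbits_coverture)
  have "card (act ` carrier G) dvd card (\<Union>(orbits G S \<phi>))"
  proof (rule dvd_partition)
    show "finite (\<Union>(orbits G S \<phi>))" using U S48 by (simp add: card_ge_0_finite)
    show "\<forall>C\<in>orbits G S \<phi>. card (act ` carrier G) dvd card C" using orb by simp
    show "\<forall>C\<in>orbits G S \<phi>. \<forall>D\<in>orbits G S \<phi>. C \<noteq> D \<longrightarrow> C \<inter> D = {}"
      using P.disjoint_union by blast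
  qed
  then show ?thesis using U S48 by simp
qed

end

section \<open>Prime exponents and characteristic quotients of finite solvable groups\<close>

declare mult_FactGroup [simp del] one_FactGroup [simp del]

lemma (in group) mult_inv_eq_one_iff:
  "\<lbrakk>a \<in> carrier G; b \<in> carrier G\<rbrakk> \<Longrightarrow> a \<otimes> inv b = \<one> \<longleftrightarrow> a = b"
  by (metis inv_closed inv_equality inv_inv r_inv)

lemma (in normal) group_hom_Mod: "group_hom G (G Mod H) (\<lambda>x. H #> x)"
  using r_coset_hom_Mod factorgroup_is_group is_group
  by (simp add: group_hom_def group_hom_axioms_def)

lemma (in normal) Mod_carrier: "carrier (G Mod H) = (\<lambda>x. H #> x) ` carrier G"
  by (auto simp: FactGroup_def RCOSETS_def)

lemma (in normal) r_coset_eq_one_iff: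
  "x \<in> carrier G \<Longrightarrow> H #> x = \<one>\<^bsub>G Mod H\<^esub> \<longleftrightarrow> x \<in> H"
  using coset_join1[OF _ _ subgroup_axioms] coset_join2[OF _ subgroup_axioms] by (auto simp: FactGroup_def)

lemma (in normal) kernel_Mod: "kernel G (G Mod H) (\<lambda>x. H #> x) = H"
  unfolding kernel_def using subset r_coset_eq_one_iff by blast

lemma (in normal) eq_carrier_if_order_Mod_one:
  assumes "order (G Mod H) = 1"
  shows "H = carrier G"
proof -
  have "carrier (G Mod H) = {\<one>\<^bsub>G Mod H\<^esub>}"
    using group.order_one_triv_iff[OF factorgroup_is_group] assms by simp
  then have "H #> x = \<one>\<^bsub>G Mod H\<^esub>" if "x \<in> carrier G" for x
    using that unfolding Mod_carrier by blast
  then show ?thesis using r_coset_eq_one_iff subset by blast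
qed

text \<open>If all prime power maps were onto, composing them would make every positive power map
  onto, including the one with exponent \<open>order G\<close>, which is constant.\<close>

lemma (in group) exists_prime_pow_not_surj:
  assumes "finite (carrier G)" "order G > 1"
  obtains p :: nat where "Factorial_Ring.prime p" "\<not> carrier G \<subseteq> (\<lambda>b. b [^] p) ` carrier G"
proof (rule ccontr)
  assume "\<not> thesis"
  then have surj: "\<And>p::nat. Factorial_Ring.prime p \<Longrightarrow> carrier G \<subseteq> (\<lambda>b. b [^] p) ` carrier G"
    using that by blast
  have "n > 0 \<longrightarrow> carrier G \<subseteq> (\<lambda>b. b [^] n) ` carrier G" for n :: nat
  proof (induction n rule: prime_divisors_induct)
    case (factor p n)
    show ?case
    proof (intro impI subsetI)
      fix a assume n: "0 < p * n" and a: "a \<in> carrier G"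
      obtain b where b: "b \<in> carrier G" "a = b [^] p" using surj[OF factor(1)] a by blast
      obtain c where c: "c \<in> carrier G" "b = c [^] n" using factor(2) n b(1) by auto
      have "a = c [^] (p * n)" using b c nat_pow_pow[of c n p] by (simp add: mult.commute)
      then show "a \<in> (\<lambda>b. b [^] (p * n)) ` carrier G" using c(1) by blast
    qed
  qed auto
  then have "carrier G \<subseteq> (\<lambda>b. b [^] order G) ` carrier G" using assms(2) by auto
  then have "carrier G \<subseteq> {\<one>}" using pow_order_eq_1 by auto
  then have "order G \<le> card {\<one>}" unfolding order_def by (intro card_mono) auto
  then show False using assms(2) by simp
qed

lemma prime_power_if_unique_prime_divisor:
  fixes n p :: nat
  assumes p: "Factorial_Ring.prime p" and "n \<noteq> 0"
    and u: "\<And>q. Factorial_Ring.prime q \<Longrightarrow> q dvd n \<Longrightarrow> q = p"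
  shows "\<exists>m. n = p ^ m"
proof -
  obtain y where y: "n = p ^ multiplicity p n * y" "\<not> p dvd y"
    using multiplicity_decompose'[OF assms(2), of p] p by (metis not_prime_unit)
  have "y = 1"
  proof (rule ccontr)
    assume "y \<noteq> 1"
    then obtain q where q: "Factorial_Ring.prime q" "q dvd y" using prime_factor_nat by blast
    then have "q dvd n" using y(1) by (metis dvd_mult)
    then show False using u q y(2) by blast
  qed
  then show ?thesis using y(1) by auto
qed

text \<open>For a prime \<open>q\<close> dividing the order, a nontrivial element of a subgroup of
  order \<open>q\<close> has order dividing both \<open>q\<close> and \<open>p\<close>.\<close>

lemma (in group) order_prime_power_if_exponent:
  assumes fin: "finite (carrier G)" and p: "Factorial_Ring.prime p"
    and ex: "\<And>a. a \<in> carrier G \<Longrightarrow> a [^] p = \<one>"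
  obtains m where "order G = p ^ m"
proof -
  have *: "q = p" if q: "Factorial_Ring.prime q" "q dvd order G" for q
  proof -
    \<comment> \<open>Sylow's theorem with exponent 1 serves as Cauchy's theorem; \<open>l\<close>
      may still be divisible by \<open>q\<close>.\<close>
    obtain l where "order G = q ^ 1 * l" using q(2) by (auto simp: dvd_def)
    then obtain S where S: "subgroup S G" "card S = q"
      using sylow_thm[OF q(1) is_group _ fin, of 1 l] by auto
    have "S \<noteq> {\<one>}" using S(2) q(1) by auto
    then obtain x where x: "x \<in> S" "x \<noteq> \<one>" using subgroup.one_closed[OF S(1)] by blast
    have xG: "x \<in> carrier G" using subgroup.subset[OF S(1)] x(1) by blast
    have "x [^]\<^bsub>G\<lparr>carrier := S\<rparr>\<^esub> order (G\<lparr>carrier := S\<rparr>) = \<one>\<^bsub>G\<lparr>carrier := S\<rparr>\<^esub>"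
      by (rule group.pow_order_eq_1[OF subgroup.subgroup_is_group[OF S(1) is_group]]) (simp add: x)
    then have "x [^] q = \<one>" using S(2) by (simp add: order_def nat_pow_consistent[symmetric])
    then have "ord x dvd q" "ord x dvd p" using pow_eq_id[OF xG] ex[OF xG] by auto
    moreover have "ord x \<noteq> 1" using ord_eq_1[OF xG] x(2) by simp
    ultimately show ?thesis using q(1) p by (metis prime_nat_iff)
  qed
  have "order G \<noteq> 0" using fin order_gt_0_iff_finite by simp
  then show thesis using prime_power_if_unique_prime_divisor[OF p] * that by blast
qed

text \<open>Otherwise the derived series is constant and never reaches the trivial group.\<close>

lemma (in group) derived_proper:
  assumes "solvable G" "order G > 1"
  shows "derived G (carrier G) \<noteq> carrier G"
proof
  assume d: "derived G (carrier G) = carrier G"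
  obtain n where "(derived G ^^ n) (carrier G) = {\<one>}"
    using assms(1) solvable_iff_trivial_derived_seq by blast
  moreover have "(derived G ^^ n) (carrier G) = carrier G" by (induction n) (simp_all add: d)
  ultimately show False using assms(2) by (simp add: order_def)
qed

text \<open>The subgroup is \<open>G\<^sup>p[G,G]\<close>, for a prime \<open>p\<close> such that the \<open>p\<close>-th power map of the
  abelianization is not onto.\<close>

lemma (in group) exists_char_elementary_abelian_quotient:
  assumes fin: "finite (carrier G)" and "solvable G" "order G > 1"
  obtains p M m where "Factorial_Ring.prime p" "M \<lhd> G" "\<forall>f\<in>hom G G. f ` M \<subseteq> M"
    "comm_group (G Mod M)" "\<forall>C\<in>carrier (G Mod M). C [^]\<^bsub>G Mod M\<^esub> p = \<one>\<^bsub>G Mod M\<^esub>"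
    "order (G Mod M) = p ^ m" "m > 0"
proof -
  let ?D = "derived G (carrier G)"
  interpret D: normal ?D G by (rule derived_self_is_normal)
  interpret A: comm_group "G Mod ?D" by (rule derived_quot_is_comm_group)
  interpret \<pi>: group_hom G "G Mod ?D" "\<lambda>x. ?D #> x" by (rule D.group_hom_Mod)
  have finA: "finite (carrier (G Mod ?D))" using fin by (simp add: D.Mod_carrier)
  have "order (G Mod ?D) \<noteq> 1"
  proof
    assume "order (G Mod ?D) = 1"
    then show False using derived_proper[OF assms(2,3)] D.eq_carrier_if_order_Mod_one by simp
  qed
  moreover have "order (G Mod ?D) > 0" using finA A.order_gt_0_iff_finite by simp
  ultimately have "order (G Mod ?D) > 1" by linarith
  then obtain p :: nat where p: "Factorial_Ring.prime p"
    and ns: "\<not> carrier (G Mod ?D) \<subseteq> (\<lambda>b. b [^]\<^bsub>G Mod ?D\<^esub> p) ` carrier (G Mod ?D)"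
    using A.exists_prime_pow_not_surj[OF finA] by blast
  let ?P = "(\<lambda>b. b [^]\<^bsub>G Mod ?D\<^esub> p) ` carrier (G Mod ?D)"
  interpret pw: group_hom "G Mod ?D" "G Mod ?D" "\<lambda>b. b [^]\<^bsub>G Mod ?D\<^esub> p"
    by unfold_locales (auto simp: hom_def A.nat_pow_distrib)
  have sP: "subgroup ?P (G Mod ?D)" by (rule pw.img_is_subgroup)
  interpret P: normal ?P "G Mod ?D" by (rule A.normal_iff_subgroup[THEN iffD2, OF sP])
  interpret q: group_hom "G Mod ?D" "(G Mod ?D) Mod ?P" "\<lambda>a. ?P #>\<^bsub>G Mod ?D\<^esub> a" by (rule P.group_hom_Mod)
  define h where "h = (\<lambda>x. ?P #>\<^bsub>G Mod ?D\<^esub> (?D #> x))"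
  interpret h: group_hom G "(G Mod ?D) Mod ?P" h
    by unfold_locales (auto simp: hom_def h_def)
  define M where "M = kernel G ((G Mod ?D) Mod ?P) h"
  \<comment> \<open>Membership is expressed through powers and the derived subgroup, both respected
    by every endomorphism. The invariance of \<open>M\<close>, the inclusion of the derived subgroup
    and the exponent of the quotient all follow from this criterion.\<close>
  have Mmem: "x \<in> M \<longleftrightarrow> (\<exists>y\<in>carrier G. x \<otimes> inv (y [^] p) \<in> ?D)" if x: "x \<in> carrier G" for x
  proof -
    have "x \<in> M \<longleftrightarrow> ?D #> x \<in> ?P"
      using x P.r_coset_eq_one_iff[OF \<pi>.hom_closed[OF x]] by (simp add: M_def kernel_def h_def)
    also have "\<dots> \<longleftrightarrow> (\<exists>y\<in>carrier G. ?D #> x = (?D #> y) [^]\<^bsub>G Mod ?D\<^esub> p)"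
      by (auto simp: D.Mod_carrier)
    also have "\<dots> \<longleftrightarrow> (\<exists>y\<in>carrier G. ?D #> (x \<otimes> inv (y [^] p)) = \<one>\<^bsub>G Mod ?D\<^esub>)"
    proof (rule bex_cong[OF refl])
      fix y assume y: "y \<in> carrier G"
      have "?D #> (x \<otimes> inv (y [^] p)) = (?D #> x) \<otimes>\<^bsub>G Mod ?D\<^esub> inv\<^bsub>G Mod ?D\<^esub> ((?D #> y) [^]\<^bsub>G Mod ?D\<^esub> p)"
        using x y \<pi>.hom_mult[OF x inv_closed[OF nat_pow_closed[OF y]]]
          \<pi>.hom_inv[OF nat_pow_closed[OF y]] \<pi>.hom_nat_pow[OF y] by metis
      moreover have "(?D #> x) \<otimes>\<^bsub>G Mod ?D\<^esub> inv\<^bsub>G Mod ?D\<^esub> ((?D #> y) [^]\<^bsub>G Mod ?D\<^esub> p) = \<one>\<^bsub>G Mod ?D\<^esub>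
          \<longleftrightarrow> ?D #> x = (?D #> y) [^]\<^bsub>G Mod ?D\<^esub> p"
        by (rule A.mult_inv_eq_one_iff[OF \<pi>.hom_closed[OF x] A.nat_pow_closed[OF \<pi>.hom_closed[OF y]]])
      ultimately show "?D #> x = (?D #> y) [^]\<^bsub>G Mod ?D\<^esub> p \<longleftrightarrow>
          ?D #> (x \<otimes> inv (y [^] p)) = \<one>\<^bsub>G Mod ?D\<^esub>" by simp
    qed
    also have "\<dots> \<longleftrightarrow> (\<exists>y\<in>carrier G. x \<otimes> inv (y [^] p) \<in> ?D)"
      using x by (intro bex_cong[OF refl] D.r_coset_eq_one_iff) simp
    finally show ?thesis .
  qed
  have MG: "M \<subseteq> carrier G" by (auto simp: M_def kernel_def)
  have nM: "M \<lhd> G" unfolding M_def by (rule h.normal_kernel)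
  interpret M: normal M G by (rule nM)
  interpret Q: group "G Mod M" by (rule M.factorgroup_is_group)
  interpret r: group_hom G "G Mod M" "\<lambda>x. M #> x" by (rule M.group_hom_Mod)
  have char: "f ` M \<subseteq> M" if f: "f \<in> hom G G" for f
  proof -
    interpret f: group_hom G G f using f by unfold_locales
    have fD: "f ` ?D \<subseteq> ?D"
      unfolding f.derived_img[OF subset_refl, symmetric] by (rule mono_derived) auto
    show ?thesis
    proof (rule image_subsetI)
      fix x assume x: "x \<in> M"
      then have xG: "x \<in> carrier G" using MG by blast
      obtain y where y: "y \<in> carrier G" "x \<otimes> inv (y [^] p) \<in> ?D" using Mmem[OF xG] x by blast
      have "f (x \<otimes> inv (y [^] p)) \<in> ?D" using fD y(2) by blast
      then have "f x \<otimes> inv (f y [^] p) \<in> ?D" using xG y(1) by (simp add: f.hom_nat_pow)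
      then show "f x \<in> M" using Mmem[OF f.hom_closed[OF xG]] f.hom_closed[OF y(1)] by blast
    qed
  qed
  have DM: "?D \<subseteq> M"
  proof
    fix x assume x: "x \<in> ?D"
    then have "x \<otimes> inv (\<one> [^] p) \<in> ?D" using D.subset by auto
    then show "x \<in> M" using Mmem[of x] x D.subset by blast
  qed
  have com: "comm_group (G Mod M)"
  proof (rule Q.group_comm_groupI)
    fix C E assume "C \<in> carrier (G Mod M)" "E \<in> carrier (G Mod M)"
    then obtain x y where xy: "x \<in> carrier G" "y \<in> carrier G" "C = M #> x" "E = M #> y"
      using M.Mod_carrier by auto
    have "x \<otimes> y \<otimes> inv (y \<otimes> x) = x \<otimes> y \<otimes> inv x \<otimes> inv y"
      using xy by (simp add: inv_mult_group m_assoc)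
    then have "x \<otimes> y \<otimes> inv (y \<otimes> x) \<in> ?D"
      unfolding derived_def using xy by (intro generate.incl) auto
    then have "x \<otimes> y \<otimes> inv (y \<otimes> x) \<in> M" using DM by blast
    then have "x \<otimes> y \<in> M #> (y \<otimes> x)"
      by (intro M.rcos_module_rev[OF is_group]) (use xy in auto)
    then have "M #> (y \<otimes> x) = M #> (x \<otimes> y)"
      by (rule repr_independence[OF _ _ M.subgroup_axioms]) (use xy in auto)
    then show "C \<otimes>\<^bsub>G Mod M\<^esub> E = E \<otimes>\<^bsub>G Mod M\<^esub> C" using xy r.hom_mult by metis
  qed
  have exponent: "C [^]\<^bsub>G Mod M\<^esub> p = \<one>\<^bsub>G Mod M\<^esub>" if C: "C \<in> carrier (G Mod M)" for C
  proof -
    obtain x where x: "x \<in> carrier G" "C = M #> x" using C M.Mod_carrier by auto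
    have "x [^] p \<otimes> inv (x [^] p) \<in> ?D" using x D.one_closed by simp
    then have "x [^] p \<in> M" using Mmem[of "x [^] p"] x by blast
    then show ?thesis using M.r_coset_eq_one_iff[of "x [^] p"] r.hom_nat_pow[OF x(1)] x by simp
  qed
  have finQ: "finite (carrier (G Mod M))" using fin by (simp add: M.Mod_carrier)
  obtain m where m: "order (G Mod M) = p ^ m"
    using Q.order_prime_power_if_exponent[OF finQ p exponent] by blast
  \<comment> \<open>A trivial quotient would mean that every element of the abelianization is a
    \<open>p\<close>-th power, against the choice of \<open>p\<close>.\<close>
  have "m > 0"
  proof (rule ccontr)
    assume "\<not> m > 0"
    then have "M = carrier G" using m M.eq_carrier_if_order_Mod_one by simp
    have "carrier (G Mod ?D) \<subseteq> ?P"
    proof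
      fix C assume "C \<in> carrier (G Mod ?D)"
      then obtain x where x: "x \<in> carrier G" "C = ?D #> x" unfolding D.Mod_carrier by blast
      have "x \<in> M" using x(1) \<open>M = carrier G\<close> by simp
      then have "?P #>\<^bsub>G Mod ?D\<^esub> C = \<one>\<^bsub>G Mod ?D Mod ?P\<^esub>"
        unfolding M_def kernel_def h_def x(2) by simp
      then show "C \<in> ?P"
        using P.r_coset_eq_one_iff[OF \<pi>.hom_closed[OF x(1)]] unfolding x(2) by (rule iffD1[rotated])
    qed
    then show False using ns by contradiction
  qed
  then show thesis using char exponent by (intro that[OF p nM _ com _ m]) simp_all
qed

section \<open>Groups of order 2^r n0 and the induction on r\<close>

text \<open>The shape of \<open>n0\<close> enters through \<open>prime_sq\<close> and
  \<open>not_27_dvd\<close>: an odd prime power dividing \<open>n0\<close> with positive exponent is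
  a prime or 9. The assumption \<open>base\<close> is phrased with crossed homomorphisms in place of
  regular subgroups.\<close>

locale minimal_order =
  fixes n0 :: nat
  assumes n0_pos: "n0 > 0"
    and prime_sq: "\<And>p. \<lbrakk>Factorial_Ring.prime p; odd p; p\<^sup>2 dvd n0\<rbrakk> \<Longrightarrow> p = 3"
    and not_27_dvd: "\<not> 27 dvd n0"
    and base: "\<And>(G :: nat monoid) (N :: nat monoid) f g.
      \<lbrakk>crossed_hom G N f g; bij_betw g (carrier G) (carrier N); order G = n0; solvable N\<rbrakk> \<Longrightarrow> solvable G"
    and index_two_power: "\<And>(G :: nat monoid) H k.
      \<lbrakk>group G; order G = n0; \<not> solvable G; subgroup H G; card (rcosets\<^bsub>G\<^esub> H) = 2 ^ k\<rbrakk>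
      \<Longrightarrow> \<not> solvable (G\<lparr>carrier := H\<rparr>)"
    and not_simple: "\<And>(G :: nat monoid) r.
      \<lbrakk>r > 0; order G = 2 ^ r * n0; simple_group G\<rbrakk> \<Longrightarrow> comm_group G"
    and half_solvable: "even n0 \<Longrightarrow> solvable_number (n0 div 2)"
    and odd_quotient_solvable: "\<And>p r. \<lbrakk>Factorial_Ring.prime p; odd p; p dvd n0\<rbrakk>
      \<Longrightarrow> solvable_number ((2 ^ r * n0) div p)"
begin

lemma order_finite: "order G = 2 ^ r * n0 \<Longrightarrow> finite (carrier G)"
  using n0_pos by (intro card_ge_0_finite) (simp add: order_def)

lemma odd_prime_power_dvd:
  assumes "Factorial_Ring.prime p" "odd p" "p ^ m dvd 2 ^ r * n0"
  shows "p ^ m dvd n0"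
proof -
  have "coprime (p ^ m) (2 ^ r)" using assms(2) by simp
  then show ?thesis using assms(3) by (simp add: coprime_dvd_mult_right_iff)
qed

text \<open>The odd prime \<open>p\<close> must divide \<open>n0\<close>, so the order divides the
  solvable number \<open>(2 ^ r * n0) div p\<close>. This covers H for odd \<open>p\<close> as well
  as permutation groups of order dividing 48.\<close>

lemma solvable_if_order_dvd:
  assumes "group G" "Factorial_Ring.prime p" "odd p" "order G * p dvd 2 ^ r * n0"
  shows "solvable G"
proof -
  obtain u where u: "2 ^ r * n0 = order G * p * u" using assms(4) by blast
  then have "p dvd 2 ^ r * n0" by simp
  then have p: "p dvd n0" using odd_prime_power_dvd[of p 1 r] assms by simp
  have d: "(2 ^ r * n0) div p = order G * u" using u assms(2) prime_gt_0_nat by simp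
  have "order G * u > 0" using u n0_pos by (metis gr0I mult_is_0 mult.assoc mult.commute power_not_zero zero_neq_numeral)
  then show ?thesis
    by (intro solvable_number_dvd[OF odd_quotient_solvable[OF assms(2,3) p, of r]])
      (use d assms(1) in simp_all)
qed

text \<open>An odd prime in the cofactor \<open>t\<close> would make \<open>G\<close> solvable, so
  \<open>t\<close> is a power of 2, and \<open>s\<close> is \<open>r\<close> minus its
  exponent.\<close>

lemma order_if_not_solvable:
  assumes G: "group G" "\<not> solvable G" and dvd: "order G dvd 2 ^ r * n0"
  obtains s where "order G = 2 ^ s * n0"
proof -
  obtain t where t: "2 ^ r * n0 = order G * t" using dvd by blast
  have t0: "t \<noteq> 0" "order G \<noteq> 0" using t n0_pos by (metis mult_is_0 less_numeral_extra(3) power_not_zero zero_neq_numeral)+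
  have "q = 2" if q: "Factorial_Ring.prime q" "q dvd t" for q
  proof (rule ccontr)
    assume "q \<noteq> 2"
    then have "odd q" using q(1) primes_dvd_imp_eq two_is_prime_nat by blast
    moreover have "order G * q dvd 2 ^ r * n0" using t q(2) by simp
    ultimately show False using solvable_if_order_dvd G q(1) by blast
  qed
  then obtain a where a: "t = 2 ^ a"
    using prime_power_if_unique_prime_divisor[OF two_is_prime_nat t0(1)] by blast
  show thesis
  proof (cases "a \<le> r")
    case True
    then have "(2::nat) ^ r = 2 ^ a * 2 ^ (r - a)" by (simp add: power_add[symmetric])
    then have "2 ^ a * (2 ^ (r - a) * n0) = 2 ^ a * order G" using t a by (simp add: mult_ac)
    then show thesis using that[of "r - a"] by simp
  next
    \<comment> \<open>If the cofactor exceeds \<open>2 ^ r\<close>, some factors 2 come out of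
      \<open>n0\<close>, and the order divides the solvable number \<open>n0 div 2\<close>.\<close>
    case False
    then have "(2::nat) ^ a = 2 ^ r * 2 ^ (a - r)" by (simp add: power_add[symmetric])
    then have "2 ^ r * n0 = 2 ^ r * (order G * 2 ^ (a - r))" using t a by (simp add: mult_ac)
    then have n0: "n0 = order G * 2 ^ (a - r)" by simp
    have "(2::nat) ^ (a - r) = 2 * 2 ^ (a - r - 1)" using False by (simp add: power_eq_if)
    then have n2: "n0 = 2 * (order G * 2 ^ (a - r - 1))" using n0 by simp
    then have "even n0" "n0 div 2 = order G * 2 ^ (a - r - 1)" by simp_all
    then have "solvable G"
      by (intro solvable_number_dvd[OF half_solvable _ _ G(1)]) (use t0(2) in simp_all)
    then show thesis using G(2) by contradiction
  qed
qed

text \<open>The index is encoded as an equation of orders because that factors directly along a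
  normal subgroup and its quotient.\<close>

lemma subgroup_index_two_power_not_solvable:
  fixes W :: "nat monoid"
  assumes "group W" "\<not> solvable W" "order W = 2 ^ s * n0" "subgroup Y W" "order W = 2 ^ k * card Y"
  shows "\<not> solvable (W\<lparr>carrier := Y\<rparr>)"
  using assms
proof (induction s arbitrary: W Y k rule: less_induct)
  case (less s)
  interpret W: group W by fact
  have card0: "order W \<noteq> 0" using less.prems(3) n0_pos by simp
  show ?case
  proof (cases "s = 0")
    case True
    have "card (rcosets\<^bsub>W\<^esub> Y) * card Y = 2 ^ k * card Y"
      using W.lagrange[OF less.prems(4)] less.prems(5) by simp
    then have "card (rcosets\<^bsub>W\<^esub> Y) = 2 ^ k" using card0 less.prems(5) by simp
    then show ?thesis using index_two_power less.prems True by simp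
  next
    case False
    have fin: "finite (carrier W)" by (rule order_finite[OF less.prems(3)])
    \<comment> \<open>For \<open>s > 0\<close> a simple \<open>W\<close> would be abelian and hence
      solvable.\<close>
    have "\<not> simple_group W"
      using not_simple[of s W] False less.prems comm_group_solvable by blast
    moreover have "order W \<noteq> 1"
      using less.prems(2) W.order_one_triv_iff solvable_seq.unity[of W] by (auto simp: solvable_def)
    ultimately obtain K where K: "K \<lhd> W" "K \<noteq> carrier W" "K \<noteq> {\<one>\<^bsub>W\<^esub>}"
      using card0 W.is_group unfolding simple_group_def simple_group_axioms_def
      by (metis One_nat_def Suc_lessI neq0_conv)
    interpret K: normal K W by (rule K(1))
    have "group (W Mod K)" "finite (carrier (W Mod K))"
      using fin by (auto simp: K.Mod_carrier K.factorgroup_is_group)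
    then obtain Z :: "nat monoid" and h where Z: "group Z" "h \<in> iso (W Mod K) Z" "finite (carrier Z)"
      by (rule group_nat_copy)
    interpret Z: group Z by fact
    define \<theta> where "\<theta> x = h (K #>\<^bsub>W\<^esub> x)" for x
    interpret q: group_hom W "W Mod K" "\<lambda>x. K #>\<^bsub>W\<^esub> x" by (rule K.group_hom_Mod)
    interpret h: group_hom "W Mod K" Z h
      using Z(2) by unfold_locales (simp add: iso_def)
    interpret \<theta>: group_hom W Z \<theta>
      by unfold_locales (auto simp: hom_def \<theta>_def)
    have surj: "\<theta> ` carrier W = carrier Z"
      using Z(2) by (auto simp: iso_def bij_betw_def K.Mod_carrier \<theta>_def)
    have hone: "h a = \<one>\<^bsub>Z\<^esub> \<longleftrightarrow> a = \<one>\<^bsub>W Mod K\<^esub>" if "a \<in> carrier (W Mod K)" for a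
      using Z(2) that h.hom_one q.H.one_closed by (metis (no_types, lifting) bij_betw_def inj_onD iso_def mem_Collect_eq)
    have ker: "kernel W Z \<theta> = K"
    proof -
      have "kernel W Z \<theta> = kernel W (W Mod K) (\<lambda>x. K #>\<^bsub>W\<^esub> x)"
        using hone[OF q.hom_closed] unfolding kernel_def \<theta>_def by blast
      then show ?thesis by (simp only: K.kernel_Mod)
    qed
    have oW: "order W = order Z * card K"
      using \<theta>.order_eq_image_kernel ker surj by (simp add: order_def)
    have oY: "card Y = card (\<theta> ` Y) * card (Y \<inter> K)"
      using \<theta>.card_subgroup_eq_image_kernel[OF less.prems(4)] ker by simp
    have sYK: "subgroup (Y \<inter> K) (W\<lparr>carrier := K\<rparr>)" "subgroup (Y \<inter> K) W"
      using W.subgroup_incl[OF W.subgroups_Inter_pair[OF less.prems(4) K.subgroup_axioms] K.subgroup_axioms]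
        W.subgroups_Inter_pair[OF less.prems(4) K.subgroup_axioms] by auto
    interpret WK: group "W\<lparr>carrier := K\<rparr>" by (rule K.subgroup_is_group[OF W.is_group])
    have sY: "subgroup (\<theta> ` Y) Z" by (rule \<theta>.subgroup_img_is_subgroup[OF less.prems(4)])
    obtain c where c: "card K = c * card (Y \<inter> K)"
      using WK.card_subgroup_dvd_order[OF sYK(1)] by (auto simp: order_def dvd_def mult.commute)
    obtain d where d: "order Z = d * card (\<theta> ` Y)"
      using Z.card_subgroup_dvd_order[OF sY] by (auto simp: dvd_def mult.commute)
    \<comment> \<open>The index of \<open>Y\<close> is the product of the index \<open>c\<close>
      inside \<open>K\<close> and the index \<open>d\<close> inside the quotient; factors of a power
      of 2 are powers of 2.\<close>
    have "order W = (c * d) * card Y"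
      unfolding oW oY d by (subst c) (simp only: mult_ac)
    then have "(c * d) * card Y = 2 ^ k * card Y" using less.prems(5) by metis
    then have cd: "c * d = 2 ^ k" using card0 less.prems(5) by simp
    obtain i where i: "c = 2 ^ i" using cd divides_primepow_nat[OF two_is_prime_nat] by (metis dvd_triv_left)
    obtain j where j: "d = 2 ^ j" using cd divides_primepow_nat[OF two_is_prime_nat] by (metis dvd_triv_right)
    show ?thesis
    proof
      assume sol: "solvable (W\<lparr>carrier := Y\<rparr>)"
      have pos: "order Z > 0" "card K > 0" using oW card0 by auto
      show False
      proof (cases "solvable (W\<lparr>carrier := K\<rparr>)")
        \<comment> \<open>\<open>K\<close> is insolvable and proper, so induction makes
          \<open>Y \<inter> K\<close> insolvable although it lies in the solvable
          \<open>Y\<close>.\<close>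
        case False
        have "card K dvd 2 ^ s * n0" using oW less.prems(3) by (metis dvd_triv_right)
        then obtain s' where s': "card K = 2 ^ s' * n0"
          using order_if_not_solvable[OF WK.is_group False, of s] by (auto simp: order_def)
        have "card K < card (carrier W)"
          using K.subset K(2) fin by (intro psubset_card_mono) auto
        then have "(2::nat) ^ s' < 2 ^ s" using s' less.prems(3) n0_pos by (simp add: order_def)
        then have "s' < s" by simp
        then have "\<not> solvable (W\<lparr>carrier := K\<rparr>\<lparr>carrier := Y \<inter> K\<rparr>)"
          using less.IH[of s' "W\<lparr>carrier := K\<rparr>" "Y \<inter> K" i] WK.is_group False s' sYK(1) c i
          by (simp add: order_def)
        then show False
          using solvable_subgroup_mono[OF W.is_group less.prems(4) sol sYK(2)] by simp
      next
        \<comment> \<open>The quotient is insolvable and, as \<open>K\<close> is nontrivial, smaller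
          than \<open>W\<close>; by induction the image of \<open>Y\<close> is insolvable although
          \<open>Y\<close> is solvable.\<close>
        case True
        have nZ: "\<not> solvable Z"
          using \<theta>.solvable_extension ker surj True less.prems(2) by auto
        have "order Z dvd 2 ^ s * n0" using oW less.prems(3) by (metis dvd_triv_left)
        then obtain s' where s': "order Z = 2 ^ s' * n0"
          using order_if_not_solvable[OF Z(1) nZ, of s] by auto
        have "card K \<noteq> 1" using WK.order_one_triv_iff K(3) by (simp add: order_def)
        then have "order Z < order W" using oW pos by simp
        then have "(2::nat) ^ s' < 2 ^ s" using s' less.prems(3) n0_pos by simp
        then have "s' < s" by simp
        then have "\<not> solvable (Z\<lparr>carrier := \<theta> ` Y\<rparr>)"
          using less.IH[of s' Z "\<theta> ` Y" j] Z(1) nZ s' sY d j by simp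
        moreover have "solvable (Z\<lparr>carrier := \<theta> ` Y\<rparr>)"
        proof -
          interpret \<theta>Y: group_hom "W\<lparr>carrier := Y\<rparr>" Z \<theta> by (rule \<theta>.group_hom_restrict[OF less.prems(4)])
          show ?thesis using group_hom.surj_hom_imp_solvable[OF \<theta>Y.group_hom_onto_image _ sol] by simp
        qed
        ultimately show False by contradiction
      qed
    qed
  qed
qed

lemma solvable_if_crossed_hom:
  fixes G N :: "nat monoid"
  assumes "crossed_hom G N f g" "bij_betw g (carrier G) (carrier N)" "order G = 2 ^ r * n0" "solvable N"
  shows "solvable G"
  using assms
proof (induction r arbitrary: G N rule: less_induct)
  case (less r)
  interpret crossed_hom G N f g by fact
  show ?case
  proof (rule ccontr)
    assume nG: "\<not> solvable G"
    have finG: "finite (carrier G)" by (rule order_finite[OF less.prems(3)])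
    have oN: "order N = order G" using bij_betw_same_card[OF less.prems(2)] by (simp add: order_def)
    have finN: "finite (carrier N)" using order_finite[of N r] oN less.prems(3) by simp
    have "order G \<noteq> 1"
      using nG G.order_one_triv_iff solvable_seq.unity[of G] by (auto simp: solvable_def)
    moreover have "order G \<noteq> 0" using less.prems(3) n0_pos by simp
    ultimately have "order N > 1" using oN by linarith
    then obtain p M m where p: "Factorial_Ring.prime p" and M: "M \<lhd> N"
      and char: "\<forall>f\<in>hom N N. f ` M \<subseteq> M" and comm: "comm_group (N Mod M)"
      and exponent: "\<forall>C\<in>carrier (N Mod M). C [^]\<^bsub>N Mod M\<^esub> p = \<one>\<^bsub>N Mod M\<^esub>"
      and oQ: "order (N Mod M) = p ^ m" and m: "m > 0"
      by (rule N.exists_char_elementary_abelian_quotient[OF finN less.prems(4)])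
    interpret M: normal M N by (rule M)
    define H where "H = {x \<in> carrier G. g x \<in> M}"
    have fM: "f x ` M \<subseteq> M" if "x \<in> carrier G" for x using char f_hom[OF that] by (rule bspec)
    have sH: "subgroup H G" unfolding H_def by (rule subgroup_g_vimage[OF M.subgroup_axioms fM])
    have gH: "bij_betw g H M"
      using less.prems(2) M.subset unfolding H_def bij_betw_def by (fastforce intro: inj_on_subset)
    have oM: "card M * p ^ m = 2 ^ r * n0"
      using N.lagrange[OF M.subgroup_axioms] oQ oN less.prems(3)
      by (simp add: order_def FactGroup_def mult.commute)
    have oH: "card H * p ^ m = 2 ^ r * n0" using oM bij_betw_same_card[OF gH] by simp
    have gHr: "group (G\<lparr>carrier := H\<rparr>)" by (rule subgroup.subgroup_is_group[OF sH G.is_group])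
    show False
    proof (cases "p = 2")
      case True
      show False
      proof (cases "solvable (G\<lparr>carrier := H\<rparr>)")
        \<comment> \<open>A solvable H of index \<open>2 ^ m\<close> contradicts the result on
          subgroups of 2-power index.\<close>
        case True
        have "order G = 2 ^ m * card H" using oH less.prems(3) \<open>p = 2\<close> by (simp add: mult.commute)
        then show False
          using subgroup_index_two_power_not_solvable[OF G.is_group nG less.prems(3) sH] True by blast
      next
        case False
        have "card H dvd 2 ^ r * n0" using oH by (metis dvd_triv_left)
        then obtain s where s: "card H = 2 ^ s * n0"
          using order_if_not_solvable[OF gHr False, of r] by (auto simp: order_def)
        \<comment> \<open>Comparing orders gives \<open>s + m = r\<close>, and \<open>m > 0\<close>
          yields the strict decrease required by the induction.\<close>
        have "(2::nat) ^ (s + m) * n0 = 2 ^ r * n0" using oH s \<open>p = 2\<close> by (simp add: power_add mult_ac)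
        then have "(2::nat) ^ (s + m) = 2 ^ r" using n0_pos by simp
        then have "s < r" using m by simp
        have "crossed_hom (G\<lparr>carrier := H\<rparr>) (N\<lparr>carrier := M\<rparr>) f g"
          unfolding H_def by (rule crossed_hom_restrict[OF M.subgroup_axioms fM])
        then have "solvable (G\<lparr>carrier := H\<rparr>)"
          using less.IH[OF \<open>s < r\<close>, of "G\<lparr>carrier := H\<rparr>" "N\<lparr>carrier := M\<rparr>"] gH s
            solvable_subgroup_group[OF N.is_group less.prems(4) M.subgroup_axioms]
          by (simp add: order_def)
        then show False using False by contradiction
      qed
    next
      case False
      then have odd: "odd p" using p primes_dvd_imp_eq two_is_prime_nat by blast
      have pm: "p ^ m dvd n0"
        using odd_prime_power_dvd[OF p odd, of m r] oH by (metis dvd_triv_right)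
      have "p dvd p ^ m" using m by simp
      then have "card H * p dvd 2 ^ r * n0" using oH by (metis mult_dvd_mono dvd_refl)
      then have solH: "solvable (G\<lparr>carrier := H\<rparr>)"
        using solvable_if_order_dvd[OF gHr p odd, of r] by (simp add: order_def)
      interpret Q: crossed_hom G "N Mod M" "\<lambda>x C. f x ` C" "\<lambda>x. M #>\<^bsub>N\<^esub> g x"
        by (rule crossed_hom_quotient[OF M fM])
      \<comment> \<open>The fibre of the quotient crossed homomorphism over the identity is the
        solvable subgroup \<open>H\<close>.\<close>
      have "{x \<in> carrier G. M #>\<^bsub>N\<^esub> g x = \<one>\<^bsub>N Mod M\<^esub>} = H"
        unfolding H_def using M.r_coset_eq_one_iff[OF g_closed] by blast
      then have solH': "solvable (G\<lparr>carrier := {x \<in> carrier G. M #>\<^bsub>N\<^esub> g x = \<one>\<^bsub>N Mod M\<^esub>}\<rparr>)"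
        using solH by simp
      show False
      proof (cases "m = 1")
        case True
        then show False using Q.solvable_if_prime_order[OF comm _ solH'] oQ p nG by simp
      next
        case False
        then have "m \<ge> 2" using m by simp
        then have "p\<^sup>2 dvd n0" using pm by (meson dvd_trans le_imp_power_dvd)
        then have p3: "p = 3" using prime_sq p odd by blast
        have "\<not> m \<ge> 3"
        proof
          assume "m \<ge> 3"
          then have "p ^ 3 dvd n0" using pm by (meson dvd_trans le_imp_power_dvd)
          then show False using not_27_dvd p3 by simp
        qed
        then have m2: "m = 2" using \<open>m \<ge> 2\<close> by simp
        let ?B = "BijGroup (carrier (N Mod M))\<lparr>carrier := Q.act ` carrier G\<rparr>"
        have "card (Q.act ` carrier G) dvd 48"
        proof (rule Q.card_act_dvd_48[OF finG])
          show "order (N Mod M) = 9" using oQ p3 m2 by simp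
          fix C assume C: "C \<in> carrier (N Mod M)"
          then show "C \<otimes>\<^bsub>N Mod M\<^esub> C \<otimes>\<^bsub>N Mod M\<^esub> C = \<one>\<^bsub>N Mod M\<^esub>"
            using bspec[OF exponent C] p3 by (simp add: numeral_3_eq_3)
        qed
        \<comment> \<open>The exponent 4 comes from 48 * 3 = 2^4 * 9, where 9 divides
          \<open>n0\<close>. So the order of the image lacks a factor 3 within
          \<open>2 ^ 4 * n0\<close>, and the image is solvable.\<close>
        then have "order ?B * 3 dvd 48 * 3" by (simp add: order_def mult_dvd_mono)
        also have "48 * 3 dvd 2 ^ 4 * n0" using pm p3 m2 mult_dvd_mono[of "2 ^ 4" "2 ^ 4" 9 n0] by simp
        finally have "order ?B * 3 dvd 2 ^ 4 * n0" .
        moreover have "group ?B"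
          using group_hom.img_is_subgroup[OF Q.act_hom] group_BijGroup
          by (rule subgroup.subgroup_is_group)
        ultimately have "solvable ?B" using solvable_if_order_dvd[of ?B 3 4] by simp
        then show False using Q.solvable_if_comm[OF comm solH'] nG by simp
      qed
    qed
  qed
qed

end

section \<open>Odd prime powers dividing n0\<close>

lemma prime_dvd_prod_primes_iff:
  fixes P :: "nat set"
  assumes "finite P" "\<forall>q\<in>P. Factorial_Ring.prime q" "Factorial_Ring.prime p"
  shows "p dvd \<Prod>P \<longleftrightarrow> p \<in> P"
proof
  assume "p dvd \<Prod>P"
  then obtain q where "q \<in> P" "p dvd q" using prime_dvd_prod_iff[OF assms(1,3), of "\<lambda>q. q"] by auto
  then show "p \<in> P" using assms(2,3) primes_dvd_imp_eq by blast
qed (use assms(1) in \<open>auto intro: dvd_prodI[of P _ "\<lambda>q. q", simplified]\<close>)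

lemma not_27_dvd:
  fixes P :: "nat set"
  assumes "e0 \<le> 2" "finite P" "\<forall>p\<in>P. Factorial_Ring.prime p \<and> p \<ge> 5"
  shows "\<not> 27 dvd 2 ^ r0 * 3 ^ e0 * \<Prod>P"
proof
  assume "27 dvd 2 ^ r0 * 3 ^ e0 * \<Prod>P"
  then have d: "3 ^ 3 dvd (2 ^ r0 * \<Prod>P) * 3 ^ e0" by (simp add: mult_ac)
  have 3: "Factorial_Ring.prime (3::nat)" by simp
  have "3 \<notin> P" using bspec[OF assms(3), of 3] by linarith
  then have "\<not> 3 dvd \<Prod>P" using prime_dvd_prod_primes_iff[OF assms(2) _ 3] assms(3) by metis
  then have "coprime 3 (\<Prod>P)" by (rule prime_imp_coprime[OF 3])
  moreover have "coprime (3::nat) 2" by simp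
  ultimately have "coprime (3 ^ 3) (2 ^ r0 * \<Prod>P)"
    by (intro coprime_power_left_iff[THEN iffD2] disjI1) (simp add: coprime_mult_right_iff)
  then have "(3::nat) ^ 3 dvd 3 ^ e0" using d coprime_dvd_mult_right_iff by metis
  then have "3 \<le> e0" by (rule power_dvd_imp_le) simp
  then show False using assms(1) by simp
qed

text \<open>For odd \<open>p\<close> other than 3 the square would have to divide the product over
  \<open>P\<close>, which is squarefree.\<close>

lemma odd_prime_square_dvd:
  fixes P :: "nat set"
  assumes "finite P" "\<forall>p\<in>P. Factorial_Ring.prime p"
    and p: "Factorial_Ring.prime p" "odd p" "p\<^sup>2 dvd 2 ^ r0 * 3 ^ e0 * \<Prod>P"
  shows "p = 3"
proof (rule ccontr)
  assume "p \<noteq> 3"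
  have 3: "Factorial_Ring.prime (3::nat)" by simp
  have "coprime p 3" by (rule primes_coprime[OF p(1) 3 \<open>p \<noteq> 3\<close>])
  moreover have "coprime p 2" using p(2) by simp
  ultimately have "coprime (p\<^sup>2) (2 ^ r0 * 3 ^ e0)"
    by (intro coprime_power_left_iff[THEN iffD2] disjI1) (simp add: coprime_mult_right_iff)
  then have d: "p\<^sup>2 dvd \<Prod>P" using p(3) coprime_dvd_mult_right_iff by metis
  have "p dvd p\<^sup>2" by (simp add: power2_eq_square)
  then have pP: "p \<in> P" using prime_dvd_prod_primes_iff[OF assms(1,2) p(1)] dvd_trans[OF _ d] by metis
  have "\<Prod>P = p * \<Prod>(P - {p})" using prod.remove[OF assms(1) pP, of "\<lambda>q. q"] by simp
  then have "p * p dvd p * \<Prod>(P - {p})" using d by (simp add: power2_eq_square)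
  then have "p dvd \<Prod>(P - {p})" using prime_gt_0_nat[OF p(1)] by simp
  moreover have "finite (P - {p})" "\<forall>q\<in>P - {p}. Factorial_Ring.prime q" using assms(1,2) by auto
  ultimately show False using prime_dvd_prod_primes_iff p(1) by blast
qed

section \<open>From the hypotheses on n0 to groups on arbitrary carriers\<close>

theorem theorem5p1:
  fixes n0 r0 e0 :: nat and P :: "nat set"
  assumes n0_def: "n0 = 2 ^ r0 * 3 ^ e0 * \<Prod>P"
    and e0: "e0 \<le> 2"
    and P: "finite P" "\<forall>p\<in>P. Factorial_Ring.prime p \<and> p \<ge> 5"
    and base: "\<not> (\<exists>(G :: nat monoid) (N :: nat monoid).
                 group G \<and> group N \<and> finite (carrier G) \<and> finite (carrier N)
                 \<and> order G = n0 \<and> order N = n0 \<and> \<not> solvable G \<and> solvable N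
                 \<and> E' G N \<noteq> {})"
    and h1: "\<forall>(G :: nat monoid) H. group G \<and> finite (carrier G) \<and> order G = n0
                 \<and> \<not> solvable G \<and> subgroup H G \<and> (\<exists>k. card (rcosets\<^bsub>G\<^esub> H) = 2 ^ k)
                 \<longrightarrow> \<not> solvable (G\<lparr>carrier := H\<rparr>)"
    and h2: "\<forall>r \<ge> 1. \<forall>G :: nat monoid. finite (carrier G) \<and> order G = 2 ^ r * n0
                 \<longrightarrow> \<not> (simple_group G \<and> \<not> comm_group G)"
    and h3: "even n0 \<longrightarrow> solvable_number (n0 div 2)"
    and h4: "\<forall>p r. Factorial_Ring.prime p \<and> odd p \<and> p dvd n0 \<longrightarrow> solvable_number ((2 ^ r * n0) div p)"
  shows "\<forall>r \<ge> 1. \<not> (\<exists>(G :: 'g monoid) (N :: 'n monoid).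
                 group G \<and> group N \<and> finite (carrier G) \<and> finite (carrier N)
                 \<and> order G = 2 ^ r * n0 \<and> order N = 2 ^ r * n0
                 \<and> \<not> solvable G \<and> solvable N \<and> E' G N \<noteq> {})"
proof (intro allI impI notI)
  have "0 < 2 ^ r0 * 3 ^ e0 * \<Prod>P" using P(2) by (intro mult_pos_pos prod_pos) auto
  then have pos: "n0 > 0" by (simp only: n0_def)
  have fin: "finite (carrier G)" if "order G = 2 ^ r * n0" for G :: "nat monoid" and r
    using that pos by (intro card_ge_0_finite) (simp add: order_def)
  have fin0: "finite (carrier G)" if "order G = n0" for G :: "nat monoid"
    using fin[of G 0] that by simp
  interpret minimal_order n0
  proof (rule minimal_order.intro)
    show "n0 > 0" by (rule pos)
    show "\<not> 27 dvd n0" unfolding n0_def by (rule not_27_dvd[OF e0 P])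
    show "p = 3" if "Factorial_Ring.prime p" "odd p" "p\<^sup>2 dvd n0" for p
      using odd_prime_square_dvd[OF P(1) _ that(1,2) that(3)[unfolded n0_def]] P(2) by blast
    \<comment> \<open>A bijective crossed homomorphism from an insolvable group to a solvable one
      would give a regular subgroup, contrary to the hypothesis on order \<open>n0\<close>.\<close>
    show "solvable G" if "crossed_hom G N f g" "bij_betw g (carrier G) (carrier N)" "order G = n0" "solvable N"
      for G N :: "nat monoid" and f g
    proof (rule ccontr)
      assume "\<not> solvable G"
      interpret crossed_hom G N f g by fact
      have o: "order N = n0" using bij_betw_same_card[OF that(2)] that(3) by (simp add: order_def)
      have "\<exists>(G :: nat monoid) (N :: nat monoid).
                 group G \<and> group N \<and> finite (carrier G) \<and> finite (carrier N)
                 \<and> order G = n0 \<and> order N = n0 \<and> \<not> solvable G \<and> solvable N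
                 \<and> E' G N \<noteq> {}"
        by (intro exI[of _ G] exI[of _ N] conjI G.is_group N.is_group fin0 that(3,4) o
            E'_nonempty[OF that(2)] \<open>\<not> solvable G\<close>)
      then show False using base by contradiction
    qed
    show "\<not> solvable (G\<lparr>carrier := H\<rparr>)"
      if "group G" "order G = n0" "\<not> solvable G" "subgroup H G" "card (rcosets\<^bsub>G\<^esub> H) = 2 ^ k"
      for G :: "nat monoid" and H k
      using h1 fin0[OF that(2)] that by blast
    show "comm_group G" if "r > 0" "order G = 2 ^ r * n0" "simple_group G" for G :: "nat monoid" and r
    proof -
      have "r \<ge> 1" using that(1) by simp
      then show ?thesis using h2 fin[OF that(2)] that(2,3) by blast
    qed
    show "solvable_number (n0 div 2)" if "even n0" using h3 that by blast
    show "solvable_number ((2 ^ r * n0) div p)" if "Factorial_Ring.prime p" "odd p" "p dvd n0" for p r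
      using h4 that by blast
  qed
  fix r :: nat
  assume "r \<ge> 1" and "\<exists>(G :: 'g monoid) (N :: 'n monoid).
                 group G \<and> group N \<and> finite (carrier G) \<and> finite (carrier N)
                 \<and> order G = 2 ^ r * n0 \<and> order N = 2 ^ r * n0
                 \<and> \<not> solvable G \<and> solvable N \<and> E' G N \<noteq> {}"
  then obtain G :: "'g monoid" and N :: "'n monoid"
    where GN: "group G" "group N" "finite (carrier G)" "finite (carrier N)" "order G = 2 ^ r * n0"
      "\<not> solvable G" "solvable N" "E' G N \<noteq> {}"
    by blast
  obtain f g where c: "crossed_hom G N f g" and g: "bij_betw g (carrier G) (carrier N)"
    using E'_imp_crossed_hom[OF GN(1,2,8)] .
  \<comment> \<open>The induction runs on \<open>nat\<close> carriers; solvability of the copy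
    \<open>G'\<close> is carried back to \<open>G\<close> at the end.\<close>
  obtain G' :: "nat monoid" and u where G': "group G'" "u \<in> iso G G'" using group_nat_copy[OF GN(1,3)] by blast
  obtain N' :: "nat monoid" and v where N': "group N'" "v \<in> iso N N'" using group_nat_copy[OF GN(2,4)] by blast
  have u': "inv_into (carrier G) u \<in> iso G' G" by (rule group.iso_set_sym[OF GN(1) G'(2)])
  have "bij_betw (v \<circ> g \<circ> inv_into (carrier G) u) (carrier G') (carrier N')"
    using u' g N'(2) by (auto simp: iso_def intro: bij_betw_trans)
  then have "bij_betw (\<lambda>x. v (g (inv_into (carrier G) u x))) (carrier G') (carrier N')"
    by (simp add: comp_def)
  moreover have "order G' = 2 ^ r * n0" using iso_order[OF G'(2)] GN(5) by simp
  moreover have "solvable N'" by (rule solvable_iso[OF N'(2) GN(2) N'(1) GN(7)])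
  ultimately have "solvable G'"
    by (rule solvable_if_crossed_hom[OF crossed_hom.crossed_hom_transfer[OF c G'(2) N'(2) G'(1) N'(1)]])
  then show False using solvable_iso[OF u' G'(1) GN(1)] GN(6) by blast
qed

end
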